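(* Let $\{X_t\}_{t\in\mathbb Z}$ be an SFIEGARCH$(p,d,q)_s$ process with $d<0.5$. Suppose that $\gamma$ and $\theta$ are not both equal to zero and $\sigma^2_{\ln(Z_t^2)}:=\mathrm{Var}(\ln(Z_0^2))<\infty$. Then the autocovariance function of the process $\{\ln(X_t^2)\}_{t\in\mathbb Z}$ is given by $$\gamma_{\ln(X_t^2)}(h)=\gamma_{\ln(\sigma_t^2)}(h)+C_1\lambda_{d,|h|-1}\,\mathbb I_{\mathbb Z\setminus\{0\}}(h)+\sigma^2_{\ln(Z_t^2)}\,\mathbb I_{\{0\}}(h),\qquad h\in\mathbb Z,$$ where $C_1=\mathrm{Cov}(g(Z_0),\ln(Z_0^2))$ and $\gamma_{\ln(\sigma_t^2)}(\cdot)$ is the autocovariance function of $\{\ln(\sigma_t^2)\}_{t\in\mathbb Z}$, given by $\gamma_{\ln(\sigma_t^2)}(sh+r)=\sum_{k\in\mathbb Z}\gamma_A(sk+r)\gamma_V(sh-sk)$ for $h\in\mathbb Z$, $r\in\{0,\dots,s-1\}$. Thus, there are real functions $\mathscr G(\cdot)$ and $\mathscr K(\cdot)$ satisfying $$\lim_{h\to\infty}\sum_{r=0}^{s-1}\mathscr G(sh+r)=\sum_{k\in\mathbb Z}\gamma_A(k),\qquad \lim_{k\to\infty}\sum_{r=0}^{s-1}\mathscr K(sk+r)=\frac{\alpha(1)}{\beta(1)},$$ and, for each $r\in\{0,\dots,s-1\}$ and all $\nu>0$, $$\gamma_{\ln(\sigma_t^2)}(sh+r)=\gamma_V(sh)\mathscr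 G(sh+r)+o(h^{-\nu}),\qquad \lambda_{d,sh+r}=\pi_{d,sh}\mathscr K(sh+r)+o(h^{-\nu}),\qquad h\to\infty,$$ such that, for all $\nu>0$ and all $r\in\{0,\dots,s-1\}$, $$\gamma_{\ln(X_t^2)}(sh+r)=\gamma_V(sh)\mathscr G(sh+r)+C_1\,\pi_{d,\,s\lfloor\frac{sh+r-1}{s}\rfloor}\,\mathscr K(sh+r-1)+o(h^{-\nu}),\qquad h\to\infty.$$
   Context: An SFIEGARCH$(p,d,q)_s$ process is a process $\{X_t\}_{t\in\mathbb Z}$ defined by $X_t=\sigma_tZ_t$ and $\ln(\sigma_t^2)=\omega+\sum_{k=0}^\infty\lambda_{d,k}g(Z_{t-1-k})$ for all $t\in\mathbb Z$, where: $\{Z_t\}_{t\in\mathbb Z}$ is i.i.d. with zero mean and variance one; $g(Z_t)=\theta Z_t+\gamma[|Z_t|-\mathbb E(|Z_t|)]$ with $\theta,\gamma\in\mathbb R$; $\omega,d\in\mathbb R$; $s\ge1$ is an integer; $\alpha(z)=\sum_{i=0}^p(-\alpha_i)z^i$ and $\beta(z)=\sum_{j=0}^q(-\beta_j)z^j$ are real polynomials of orders $p,q$ with $\alpha_0=\beta_0=-1$, without common roots, and $\beta(z)\neq0$ for $|z|\le1$; and $\frac{\alpha(z)}{\beta(z)}(1-z^s)^{-d}=\sum_{k=0}^\infty\lambda_{d,k}z^k$, $|z|<1$. $\mathbb I_A(x)=1$ if $x\in A$ and $0$ otherwise (so the term with $\lambda_{d,|h|-1}$ is absent for $h=0$). $\pi_{d,k}$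 are the coefficients of $(1-z^s)^{-d}=\sum_{k\ge0}\pi_{d,k}z^k$, so $\pi_{d,sk}=\frac{\Gamma(k+d)}{\Gamma(k+1)\Gamma(d)}$ (read as $d(d+1)\cdots(d+k-1)/k!$) and $\pi_{d,k}=0$ if $s\nmid k$. Further, $\gamma_A(h)=\sum_{i=0}^\infty f_if_{i+|h|}$, $h\in\mathbb Z$, where $\frac{\alpha(z)}{\beta(z)}=\sum_{k=0}^\infty f_kz^k$, and $\gamma_V(sh)=\sigma_g^2\frac{(-1)^h\Gamma(1-2d)}{\Gamma(1-d+h)\Gamma(1-d-h)}$ for $h\in\mathbb Z$ (with $1/\Gamma$ equal to $0$ at nonpositive integers), where $\sigma_g^2=\mathrm{Var}(g(Z_0))=\theta^2+\gamma^2-[\gamma\mathbb E(|Z_0|)]^2+2\theta\gamma\mathbb E(Z_0|Z_0|)$. *)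

theory Defs
  imports "HOL-Probability.Probability" "HOL-Complex_Analysis.Complex_Analysis"
begin

section \<open>Second-order notions for real processes\<close>

definition cov :: "'a measure \<Rightarrow> ('a \<Rightarrow> real) \<Rightarrow> ('a \<Rightarrow> real) \<Rightarrow> real" where
  "cov M X Y = (\<integral>x. (X x - (\<integral>y. X y \<partial>M)) * (Y x - (\<integral>y. Y y \<partial>M)) \<partial>M)"

text \<open>
  The Bochner integral of a non-integrable function is 0, so \<^const>\<open>cov\<close> alone says nothing
  about existence of moments.  Integrability is part of the predicates below.
\<close>

definition has_finite_variance :: "'a measure \<Rightarrow> ('a \<Rightarrow> real) \<Rightarrow> bool" where
  "has_finite_variance M X \<longleftrightarrow>
     integrable M X \<and> integrable M (\<lambda>x. (X x - (\<integral>y. X y \<partial>M))\<^sup>2)"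

definition weakly_stationary :: "'a measure \<Rightarrow> (int \<Rightarrow> 'a \<Rightarrow> real) \<Rightarrow> bool" where
  "weakly_stationary M Y \<longleftrightarrow>
     (\<forall>t. has_finite_variance M (Y t)) \<and>
     (\<forall>t. (\<integral>x. Y t x \<partial>M) = (\<integral>x. Y 0 x \<partial>M)) \<and>
     (\<forall>t h. cov M (Y (t + h)) (Y t) = cov M (Y h) (Y 0))"

text \<open>Only meaningful for weakly stationary processes.\<close>

definition autocov :: "'a measure \<Rightarrow> (int \<Rightarrow> 'a \<Rightarrow> real) \<Rightarrow> int \<Rightarrow> real" where
  "autocov M Y h = cov M (Y h) (Y 0)"

text \<open>
  \<open>ln 0 = 0\<close> in HOL, so \<open>log_sq Y t\<close> is the intended random variable (and
  \<open>Var(ln Y\<^sub>t\<^sup>2) < \<infinity>\<close> has its intended meaning) only together with \<open>Y\<^sub>t \<noteq> 0\<close> almost surely.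
\<close>

definition log_sq :: "(int \<Rightarrow> 'a \<Rightarrow> real) \<Rightarrow> int \<Rightarrow> 'a \<Rightarrow> real" where
  "log_sq Y t x = ln ((Y t x)\<^sup>2)"


section \<open>Power series coefficients\<close>

text \<open>
  The functions expanded below are holomorphic on the open unit disc and commute with complex
  conjugation, so their Taylor coefficients at 0 are real and are the unique coefficients
  of a power series representing them on the disc (lemma \<open>real_taylor_coeff_sums\<close>).
\<close>

definition real_taylor_coeff :: "(complex \<Rightarrow> complex) \<Rightarrow> nat \<Rightarrow> real" where
  "real_taylor_coeff F k = Re (fps_nth (fps_expansion F 0) k)"

definition cpoly :: "real poly \<Rightarrow> complex \<Rightarrow> complex" where
  "cpoly p z = poly (map_poly complex_of_real p) z"

text \<open>\<open>powr\<close> is the principal branch; \<open>1 - z ^ s\<close> has positive real part for \<open>|z| < 1\<close>.\<close>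

definition arma_coeff :: "real poly \<Rightarrow> real poly \<Rightarrow> nat \<Rightarrow> real" where
  "arma_coeff \<alpha> \<beta> = real_taylor_coeff (\<lambda>z. cpoly \<alpha> z / cpoly \<beta> z)"

definition frac_coeff :: "nat \<Rightarrow> real \<Rightarrow> nat \<Rightarrow> real" where
  "frac_coeff s d = real_taylor_coeff (\<lambda>z. (1 - z ^ s) powr (- of_real d))"

definition sfiegarch_coeff :: "real poly \<Rightarrow> real poly \<Rightarrow> nat \<Rightarrow> real \<Rightarrow> nat \<Rightarrow> real" where
  "sfiegarch_coeff \<alpha> \<beta> s d =
     real_taylor_coeff (\<lambda>z. cpoly \<alpha> z / cpoly \<beta> z * (1 - z ^ s) powr (- of_real d))"

lemma real_taylor_coeff_sums:
  assumes hol: "F holomorphic_on ball 0 1"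
    and cnj: "\<And>z. norm z < 1 \<Longrightarrow> F (cnj z) = cnj (F z)"
    and z: "norm z < 1"
  shows "(\<lambda>k. of_real (real_taylor_coeff F k) * z ^ k) sums F z"
proof -
  let ?A = "fps_expansion F 0"
  have A: "(\<lambda>k. fps_nth ?A k * w ^ k) sums F w" if "norm w < 1" for w
    using holomorphic_power_series[OF hol, of w] that by (simp add: fps_expansion_def)
  have B: "(\<lambda>k. cnj (fps_nth ?A k) * w ^ k) sums F w" if "norm w < 1" for w
  proof -
    have "(\<lambda>k. cnj (fps_nth ?A k * cnj w ^ k)) sums cnj (F (cnj w))"
      using A[of "cnj w"] that by (simp only: sums_cnj) simp
    thus ?thesis using cnj[OF that] by simp
  qed
  have "(\<lambda>k. (fps_nth ?A k + cnj (fps_nth ?A k)) / 2 * z ^ k) sums ((F z + F z) / 2)"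
    using sums_divide[OF sums_add[OF A[OF z] B[OF z]], of 2] by (simp add: algebra_simps)
  moreover have "(c + cnj c) / 2 = of_real (Re c)" for c
    by (simp add: complex_add_cnj)
  ultimately show ?thesis by (simp add: real_taylor_coeff_def)
qed

lemma cpoly_cnj: "cpoly p (cnj z) = cnj (cpoly p z)"
  unfolding cpoly_def by (induction p) (auto simp: map_poly_pCons)

lemma cpoly_holomorphic: "cpoly p holomorphic_on A"
  unfolding cpoly_def by (intro holomorphic_intros)

lemma one_minus_power_Re_pos:
  assumes "s \<ge> 1" "norm (z :: complex) < 1"
  shows "Re (1 - z ^ s) > 0"
proof -
  have "norm (z ^ s) < 1" using assms by (simp add: norm_power power_less_one_iff)
  thus ?thesis using complex_Re_le_cmod[of "z ^ s"] by simp
qed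

lemma frac_holomorphic:
  assumes "s \<ge> 1"
  shows "(\<lambda>z. (1 - z ^ s) powr (- of_real d) :: complex) holomorphic_on ball 0 1"
  by (intro holomorphic_intros)
     (use one_minus_power_Re_pos[OF assms] in \<open>force simp: complex_nonpos_Reals_iff\<close>)

lemma frac_cnj:
  assumes "s \<ge> 1" "norm z < 1"
  shows "(1 - cnj z ^ s) powr (- of_real d) = cnj ((1 - z ^ s) powr (- of_real d))"
proof -
  let ?w = "1 - z ^ s"
  have "?w \<notin> \<real>\<^sub>\<le>\<^sub>0" using one_minus_power_Re_pos[OF assms] by (auto simp: complex_nonpos_Reals_iff)
  thus ?thesis using cnj_powr[of ?w "- of_real d"] one_minus_power_Re_pos[OF assms]
    by (auto simp: complex_nonpos_Reals_iff)
qed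

lemma sfiegarch_coeff_sums:
  assumes "s \<ge> 1" "\<And>z. norm z \<le> 1 \<Longrightarrow> cpoly \<beta> z \<noteq> 0" "norm z < 1"
  shows "(\<lambda>k. of_real (sfiegarch_coeff \<alpha> \<beta> s d k) * z ^ k) sums
           (cpoly \<alpha> z / cpoly \<beta> z * (1 - z ^ s) powr (- of_real d))"
  unfolding sfiegarch_coeff_def
  by (rule real_taylor_coeff_sums)
     (use assms in \<open>auto intro!: holomorphic_intros cpoly_holomorphic frac_holomorphic
                         simp: cpoly_cnj frac_cnj\<close>)

lemma arma_coeff_sums:
  assumes "\<And>z. norm z \<le> 1 \<Longrightarrow> cpoly \<beta> z \<noteq> 0" "norm z < 1"
  shows "(\<lambda>k. of_real (arma_coeff \<alpha> \<beta> k) * z ^ k) sums (cpoly \<alpha> z / cpoly \<beta> z)"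
  unfolding arma_coeff_def
  by (rule real_taylor_coeff_sums)
     (use assms in \<open>auto intro!: holomorphic_intros cpoly_holomorphic simp: cpoly_cnj\<close>)

lemma frac_coeff_sums:
  fixes z :: complex
  assumes "s \<ge> 1" "norm z < 1"
  shows "(\<lambda>k. of_real (frac_coeff s d k) * z ^ k) sums ((1 - z ^ s) powr (- of_real d))"
  unfolding frac_coeff_def
  by (rule real_taylor_coeff_sums)
     (use assms in \<open>auto intro!: frac_holomorphic simp: frac_cnj\<close>)

lemma frac_coeff_eq:
  assumes s: "s \<ge> 1"
  shows "frac_coeff s d k =
           (if s dvd k then pochhammer d (k div s) / fact (k div s) else 0)"
proof -
  let ?B = "fps_binomial (- of_real d :: complex)" and ?L = "fps_const (-1) * fps_X :: complex fps"
  have L: "(\<lambda>z. - (z ^ s)) has_fps_expansion - (fps_X ^ s :: complex fps)"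
    by (intro fps_expansion_intros)
  have 1: "((\<lambda>x. (1 + x) powr (- of_real d)) \<circ> (\<lambda>z::complex. - (z ^ s))) has_fps_expansion
          (?B oo (- (fps_X ^ s)))"
    using s by (intro has_fps_expansion_compose has_fps_expansion_binomial_complex L)
               (auto simp: power_0_left)
  have X: "?L oo (fps_X ^ s) = - (fps_X ^ s)"
    using s by (simp add: fps_compose_uminus fps_X_fps_compose_startby0 power_0_left flip: fps_const_neg)
  have eq: "?B oo (- (fps_X ^ s)) = (?B oo ?L) oo fps_X ^ s"
    unfolding X [symmetric] using s by (subst fps_compose_assoc) (auto simp: power_0_left)
  have gch: "(-1) ^ n * (- of_real d gchoose n) = (of_real (pochhammer d n) / fact n :: complex)" for n
    by (simp add: gbinomial_pochhammer pochhammer_of_real flip: power_mult_distrib mult.assoc)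
  have "fps_nth (fps_expansion (\<lambda>z. (1 - z ^ s) powr (- of_real d)) 0) k =
          (if s dvd k then of_real (pochhammer d (k div s) / fact (k div s)) else 0)"
    using fps_expansion_eqI[OF 1] unfolding eq
    by (simp add: o_def fps_nth_compose_X_power fps_compose_linear gch
             del: fps_const_neg)
  thus ?thesis
    by (simp add: frac_coeff_def real_taylor_coeff_def del: of_real_divide)
qed


section \<open>The process\<close>

text \<open>The process \<open>g(Z\<^sub>t)\<close>.\<close>

definition g_proc ::
    "'a measure \<Rightarrow> real \<Rightarrow> real \<Rightarrow> (int \<Rightarrow> 'a \<Rightarrow> real) \<Rightarrow> int \<Rightarrow> 'a \<Rightarrow> real" where
  "g_proc M \<theta> \<gamma> Z t x = \<theta> * Z t x + \<gamma> * (\<bar>Z t x\<bar> - (\<integral>y. \<bar>Z t y\<bar> \<partial>M))"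

text \<open>
  The polynomials are \<open>\<alpha>(z) = \<Sum>i\<le>p. (-\<alpha>\<^sub>i) z\<^sup>i\<close> with \<open>\<alpha>\<^sub>0 = -1\<close>, i.e.\ constant
  coefficient 1, and likewise for \<open>\<beta>\<close>.
  The defining series is required to converge almost surely.  Since \<open>ln 0 = 0\<close> in HOL,
  \<open>\<sigma>\<^sub>t \<noteq> 0\<close>, which is implicit in the use of \<open>ln(\<sigma>\<^sub>t\<^sup>2)\<close>, has to be stated; the sign of
  \<open>\<sigma>\<^sub>t\<close> is left open.
\<close>

locale sfiegarch = prob_space M
  for M :: "'a measure"
    and p :: nat and d :: real and q s :: nat
    and \<omega> \<theta> \<gamma> :: real
    and \<alpha> \<beta> :: "real poly"
    and Z \<sigma> X :: "int \<Rightarrow> 'a \<Rightarrow> real" +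
  assumes s_ge_1: "s \<ge> 1"
    and deg_\<alpha>: "degree \<alpha> = p"
    and deg_\<beta>: "degree \<beta> = q"
    and \<alpha>_0: "coeff \<alpha> 0 = 1"
    and \<beta>_0: "coeff \<beta> 0 = 1"
    and no_common_roots: "\<not> (\<exists>z. cpoly \<alpha> z = 0 \<and> cpoly \<beta> z = 0)"
    and \<beta>_nz: "\<And>z. norm z \<le> 1 \<Longrightarrow> cpoly \<beta> z \<noteq> 0"
    and Z_indep: "indep_vars (\<lambda>_. borel) Z UNIV"
    and Z_ident: "\<And>t. distr M borel (Z t) = distr M borel (Z 0)"
    and Z_finite_variance: "\<And>t. has_finite_variance M (Z t)"
    and Z_mean: "\<And>t. expectation (Z t) = 0"
    and Z_var: "\<And>t. variance (Z t) = 1"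
    and \<sigma>_rv: "\<And>t. random_variable borel (\<sigma> t)"
    and X_rv: "\<And>t. random_variable borel (X t)"
    and X_eq: "\<And>t. AE x in M. X t x = \<sigma> t x * Z t x"
    and \<sigma>_nz: "\<And>t. AE x in M. \<sigma> t x \<noteq> 0"
    and ln_\<sigma>_sq: "\<And>t. AE x in M.
          (\<lambda>k. sfiegarch_coeff \<alpha> \<beta> s d k * g_proc M \<theta> \<gamma> Z (t - 1 - int k) x) sums
            (log_sq \<sigma> t x - \<omega>)"


section \<open>The functions \<open>\<gamma>\<^sub>A\<close> and \<open>\<gamma>\<^sub>V\<close>\<close>

definition gamma_A :: "real poly \<Rightarrow> real poly \<Rightarrow> int \<Rightarrow> real" where
  "gamma_A \<alpha> \<beta> h = (\<Sum>i. arma_coeff \<alpha> \<beta> i * arma_coeff \<alpha> \<beta> (i + nat \<bar>h\<bar>))"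

text \<open>
  The prescribed formula gives the value at lag \<open>s h\<close> as a function of \<open>h\<close>; the function is
  only used at multiples of \<open>s\<close>, and the value 0 elsewhere is a convention.  \<^const>\<open>rGamma\<close> is the entire
  function \<open>1/\<Gamma>\<close>.
\<close>

definition gamma_V :: "nat \<Rightarrow> real \<Rightarrow> real \<Rightarrow> int \<Rightarrow> real" where
  "gamma_V s d vg n =
     (if int s dvd n then
        let h = n div int s in
          vg * ((-1) powi h * Gamma (1 - 2 * d)
                * rGamma (1 - d + of_int h) * rGamma (1 - d - of_int h))
      else 0)"

end

theory Submission
  imports Defs "HOL-Real_Asymp.Real_Asymp"
begin

text \<open>
  Write \<open>L\<close>, \<open>f\<close>, \<open>p\<close> for the coefficients of \<open>\<alpha>/\<beta> (1 - z^s)^(-d)\<close>, \<open>\<alpha>/\<beta>\<close> and \<open>(1 - z^s)^(-d)\<close>,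
  extended by 0 to the integers, so that \<open>L\<close> is the convolution of \<open>f\<close> and \<open>p\<close>
  (\<open>coeff_conv\<close>).  All zeros of \<open>\<beta>\<close> lie outside the closed unit disc, hence \<open>f\<close> decays
  geometrically, while \<open>p\<close> is square summable because \<open>d < 1/2\<close>; therefore \<open>L\<close> is square summable.
  
  \<^bold>\<open>Covariances.\<close>  The innovations \<open>g(Z\<^sub>t)\<close> are orthogonal with common variance, so the series for
  \<open>ln(\<sigma>\<^sub>t\<^sup>2)\<close>, which converges almost surely by hypothesis, also converges in mean square, and inner products
  with it may be computed term by term (\<open>orthogonal_series\<close>).  This gives the variance of \<open>g(Z\<^sub>0)\<close>
  times the autocorrelation of \<open>L\<close> as autocovariance of \<open>ln(\<sigma>\<^sub>t\<^sup>2)\<close>.  As \<open>ln(X\<^sub>t\<^sup>2) = ln(\<sigma>\<^sub>t\<^sup>2) + ln(Z\<^sub>t\<^sup>2)\<close>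
  and \<open>ln(\<sigma>\<^sub>t\<^sup>2)\<close> depends on the past of \<open>Z\<close> only, at most one of the mixed covariances survives at each
  nonzero lag, and it picks out a single coefficient of \<open>L\<close> (\<open>cov_log_sq_X\<close>).
  
  \<^bold>\<open>Factorization.\<close>  The autocorrelation of a convolution is the convolution of the autocorrelations
  (\<open>acorr_conv\<close>).  The autocorrelation of \<open>f\<close> is \<open>\<gamma>\<^sub>A\<close>; that of \<open>p\<close> is a hypergeometric series at 1,
  which Gauss's theorem (\<open>gauss_summation\<close>) evaluates to the quotient of Gamma functions in \<open>\<gamma>\<^sub>V\<close>.
  
  \<^bold>\<open>Asymptotics.\<close>  Both \<open>\<gamma>\<^sub>V(s h)\<close> and \<open>p(s h)\<close> are sequences \<open>u h\<close> which either vanish for all large \<open>h\<close>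
  or never vanish and have \<open>u (h + 1) / u h \<longlonglongrightarrow> 1\<close>.  Convolving with a geometrically decaying sequence \<open>a\<close>
  gives, in the second case, a sequence whose quotient by \<open>u h\<close> along each residue class
  modulo \<open>s\<close> tends to the sum of \<open>a\<close> over that class, by dominated convergence; \<open>G\<close> and \<open>K\<close> are these quotients,
  and the error terms are 0.  In the first case (\<open>d\<close> a nonpositive integer, or \<open>g(Z\<^sub>0)\<close> degenerate) the
  convolution itself decays geometrically, and constants serve as \<open>G\<close> and \<open>K\<close>.  Both cases are in lemma
  \<open>smoothing\<close>, which is applied to \<open>a = \<gamma>\<^sub>A\<close> and to \<open>a = f\<close>.
\<close>

section \<open>Orthogonal series in mean square\<close>

definition square_integrable :: "'a measure \<Rightarrow> ('a \<Rightarrow> real) \<Rightarrow> bool" where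
  "square_integrable M f \<longleftrightarrow> f \<in> borel_measurable M \<and> integrable M (\<lambda>x. (f x)\<^sup>2)"

lemma square_integrable_measurable [measurable_dest]:
  "square_integrable M f \<Longrightarrow> f \<in> borel_measurable M"
  by (simp add: square_integrable_def)

lemma abs_le_squares: "\<bar>a * b\<bar> \<le> a\<^sup>2 + b\<^sup>2" for a b :: real
proof -
  have "2 * \<bar>a * b\<bar> \<le> a\<^sup>2 + b\<^sup>2"
    using sum_squares_bound[of "\<bar>a\<bar>" "\<bar>b\<bar>"] by (simp add: abs_mult)
  thus ?thesis using abs_ge_zero[of "a * b"] by linarith
qed

lemma square_integrable_mult:
  assumes "square_integrable M f" "square_integrable M g"
  shows "integrable M (\<lambda>x. f x * g x)"
proof (rule Bochner_Integration.integrable_bound)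
  show "integrable M (\<lambda>x. (f x)\<^sup>2 + (g x)\<^sup>2)"
    using assms by (auto simp: square_integrable_def)
  show "(\<lambda>x. f x * g x) \<in> borel_measurable M"
    using assms by (auto simp: square_integrable_def)
  show "AE x in M. norm (f x * g x) \<le> norm ((f x)\<^sup>2 + (g x)\<^sup>2)"
    by (intro AE_I2) (simp add: abs_le_squares)
qed

lemma square_integrable_scale:
  "square_integrable M f \<Longrightarrow> square_integrable M (\<lambda>x. c * f x)"
  by (auto simp: square_integrable_def power_mult_distrib)

lemma square_integrable_add:
  assumes "square_integrable M f" "square_integrable M g"
  shows "square_integrable M (\<lambda>x. f x + g x)"
proof -
  have "integrable M (\<lambda>x. (f x)\<^sup>2 + (g x)\<^sup>2 + 2 * (f x * g x))"
    using assms square_integrable_mult[OF assms] by (auto simp: square_integrable_def)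
  thus ?thesis using assms by (auto simp: square_integrable_def power2_sum algebra_simps)
qed

lemma square_integrable_diff:
  assumes "square_integrable M f" "square_integrable M g"
  shows "square_integrable M (\<lambda>x. f x - g x)"
  using square_integrable_add[OF assms(1) square_integrable_scale[OF assms(2), of "-1"]] by simp

lemma square_integrable_sum:
  assumes "finite I" "\<And>i. i \<in> I \<Longrightarrow> square_integrable M (f i)"
  shows "square_integrable M (\<lambda>x. \<Sum>i\<in>I. f i x)"
  using assms
proof (induction rule: finite_induct)
  case empty thus ?case by (simp add: square_integrable_def)
next
  case (insert i I) thus ?case by (auto intro!: square_integrable_add)
qed

lemma integral_Cauchy_Schwarz:
  assumes "square_integrable M f" "square_integrable M g"
  shows "(\<integral>x. f x * g x \<partial>M)\<^sup>2 \<le> (\<integral>x. (f x)\<^sup>2 \<partial>M) * (\<integral>x. (g x)\<^sup>2 \<partial>M)"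
proof -
  define A B C where "A = (\<integral>x. (f x)\<^sup>2 \<partial>M)" "B = (\<integral>x. f x * g x \<partial>M)" "C = (\<integral>x. (g x)\<^sup>2 \<partial>M)"
  have quad: "0 \<le> A - 2 * c * B + c\<^sup>2 * C" for c
  proof -
    have "0 \<le> (\<integral>x. (f x - c * g x)\<^sup>2 \<partial>M)" by (rule integral_nonneg_AE) simp
    also have "(\<lambda>x. (f x - c * g x)\<^sup>2) = (\<lambda>x. (f x)\<^sup>2 - 2 * c * (f x * g x) + c\<^sup>2 * (g x)\<^sup>2)"
      by (auto simp: power2_diff power_mult_distrib)
    also have "(\<integral>x. \<dots> x \<partial>M) = A - 2 * c * B + c\<^sup>2 * C"
      using assms square_integrable_mult[OF assms]
      by (simp add: A_B_C_def square_integrable_def)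
    finally show ?thesis .
  qed
  have C0: "C \<ge> 0" unfolding A_B_C_def by (rule integral_nonneg_AE) simp
  have "B\<^sup>2 \<le> A * C"
  proof (cases "C = 0")
    case True
    have "B = 0"
    proof (rule ccontr)
      assume "B \<noteq> 0"
      thus False using quad[of "(A + 1) / (2 * B)"] True by simp
    qed
    thus ?thesis using True by simp
  next
    case False
    hence "C > 0" using C0 by simp
    thus ?thesis using quad[of "B / C"] by (simp add: field_simps power2_eq_square)
  qed
  thus ?thesis by (simp add: A_B_C_def)
qed

text \<open>
  Fatou's lemma turns a mean-square Cauchy estimate into mean-square convergence to the
  almost sure limit, so no completeness of the space of square integrable functions is needed;
  the convergence of inner products follows from the Cauchy-Schwarz inequality.
\<close>

lemma mean_square_limit:
  fixes S :: "nat \<Rightarrow> 'a \<Rightarrow> real"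
  assumes S: "\<And>n. square_integrable M (S n)"
    and W: "W \<in> borel_measurable M"
    and lim: "AE x in M. (\<lambda>n. S n x) \<longlonglongrightarrow> W x"
    and cauchy: "\<And>m n. m \<le> n \<Longrightarrow> (\<integral>x. (S n x - S m x)\<^sup>2 \<partial>M) \<le> b m"
    and b: "b \<longlonglongrightarrow> 0"
  shows "square_integrable M W"
    and "square_integrable M U \<Longrightarrow> (\<lambda>n. \<integral>x. S n x * U x \<partial>M) \<longlonglongrightarrow> (\<integral>x. W x * U x \<partial>M)"
proof -
  have meas [measurable]: "S n \<in> borel_measurable M" for n
    using S by (simp add: square_integrable_def)
  note W [measurable]
  have b0: "b m \<ge> 0" for m using cauchy[of m m] by simp
  have fatou: "(\<integral>\<^sup>+x. ennreal ((W x - S m x)\<^sup>2) \<partial>M) \<le> ennreal (b m)" for m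
  proof -
    have "(\<integral>\<^sup>+x. ennreal ((W x - S m x)\<^sup>2) \<partial>M) =
          (\<integral>\<^sup>+x. liminf (\<lambda>n. ennreal ((S n x - S m x)\<^sup>2)) \<partial>M)"
    proof (rule nn_integral_cong_AE, use lim in eventually_elim)
      case (elim x)
      have "(\<lambda>n. ennreal ((S n x - S m x)\<^sup>2)) \<longlonglongrightarrow> ennreal ((W x - S m x)\<^sup>2)"
        by (intro tendsto_ennrealI tendsto_intros elim)
      from lim_imp_Liminf[OF _ this] show ?case by simp
    qed
    also have "\<dots> \<le> liminf (\<lambda>n. \<integral>\<^sup>+x. ennreal ((S n x - S m x)\<^sup>2) \<partial>M)"
      by (rule nn_integral_liminf) measurable
    also have "\<dots> \<le> liminf (\<lambda>n. ennreal (b m))"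
    proof (rule Liminf_mono)
      show "\<forall>\<^sub>F n in sequentially. (\<integral>\<^sup>+x. ennreal ((S n x - S m x)\<^sup>2) \<partial>M) \<le> ennreal (b m)"
        using eventually_ge_at_top[of m]
      proof eventually_elim
        case (elim n)
        have "(\<integral>\<^sup>+x. ennreal ((S n x - S m x)\<^sup>2) \<partial>M) = ennreal (\<integral>x. (S n x - S m x)\<^sup>2 \<partial>M)"
          using square_integrable_diff[OF S S, of n m]
          by (intro nn_integral_eq_integral) (auto simp: square_integrable_def)
        also have "\<dots> \<le> ennreal (b m)" using cauchy[OF elim] by (rule ennreal_leI)
        finally show ?case .
      qed
    qed
    also have "\<dots> = ennreal (b m)" by (simp add: Liminf_const)
    finally show ?thesis .
  qed
  have D: "square_integrable M (\<lambda>x. W x - S m x)" for m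
    unfolding square_integrable_def
  proof
    show "integrable M (\<lambda>x. (W x - S m x)\<^sup>2)"
      by (rule integrableI_bounded) (use fatou[of m] in \<open>auto simp: less_top[symmetric] top_unique\<close>)
  qed measurable
  have Db: "(\<integral>x. (W x - S m x)\<^sup>2 \<partial>M) \<le> b m" for m
  proof -
    have "(\<integral>\<^sup>+x. ennreal ((W x - S m x)\<^sup>2) \<partial>M) = ennreal (\<integral>x. (W x - S m x)\<^sup>2 \<partial>M)"
      using D by (intro nn_integral_eq_integral) (auto simp: square_integrable_def)
    thus ?thesis using fatou[of m] b0 by (simp add: ennreal_le_iff)
  qed
  show sqW: "square_integrable M W"
    using square_integrable_add[OF D S, of 0 0] by simp
  show "(\<lambda>n. \<integral>x. S n x * U x \<partial>M) \<longlonglongrightarrow> (\<integral>x. W x * U x \<partial>M)" if U: "square_integrable M U"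
  proof -
    let ?C = "\<integral>x. (U x)\<^sup>2 \<partial>M"
    have "(\<lambda>n. (\<integral>x. W x * U x \<partial>M) - (\<integral>x. S n x * U x \<partial>M)) \<longlonglongrightarrow> 0"
    proof (rule Lim_null_comparison)
      show "(\<lambda>n. sqrt (b n * ?C)) \<longlonglongrightarrow> 0"
        using tendsto_real_sqrt[OF tendsto_mult_right[OF b, of ?C]] by (simp add: mult.commute)
      show "\<forall>\<^sub>F n in sequentially. norm ((\<integral>x. W x * U x \<partial>M) - (\<integral>x. S n x * U x \<partial>M)) \<le> sqrt (b n * ?C)"
      proof (intro always_eventually allI)
        fix n
        have "(\<integral>x. W x * U x \<partial>M) - (\<integral>x. S n x * U x \<partial>M) = (\<integral>x. (W x - S n x) * U x \<partial>M)"
          using square_integrable_mult[OF sqW U] square_integrable_mult[OF S U]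
          by (simp add: left_diff_distrib)
        moreover have "(\<integral>x. (W x - S n x) * U x \<partial>M)\<^sup>2 \<le> b n * ?C"
          using integral_Cauchy_Schwarz[OF D[of n] U] mult_right_mono[OF Db[of n], of ?C]
          by (smt (verit) integral_nonneg_AE AE_I2 zero_le_power2)
        ultimately show "norm ((\<integral>x. W x * U x \<partial>M) - (\<integral>x. S n x * U x \<partial>M)) \<le> sqrt (b n * ?C)"
          by (metis real_norm_def real_sqrt_abs real_sqrt_le_iff)
      qed
    qed
    from tendsto_diff[OF tendsto_const[of "\<integral>x. W x * U x \<partial>M"] this] show ?thesis by simp
  qed
qed

text \<open>
  By orthogonality the squared distance between two partial sums is \<open>v\<close> times a tail of
  \<open>\<Sum>k. (a k)\<^sup>2\<close>, which is the Cauchy estimate that \<open>mean_square_limit\<close> asks for.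
\<close>

lemma orthogonal_series:
  fixes \<xi> :: "nat \<Rightarrow> 'a \<Rightarrow> real"
  assumes \<xi>: "\<And>k. square_integrable M (\<xi> k)"
    and orth: "\<And>j k. (\<integral>x. \<xi> j x * \<xi> k x \<partial>M) = (if j = k then v else 0)"
    and a: "summable (\<lambda>k. (a k)\<^sup>2)"
    and W: "W \<in> borel_measurable M"
    and sums: "AE x in M. (\<lambda>k. a k * \<xi> k x) sums W x"
  shows "square_integrable M W"
    and "square_integrable M U \<Longrightarrow> (\<lambda>k. a k * (\<integral>x. \<xi> k x * U x \<partial>M)) sums (\<integral>x. W x * U x \<partial>M)"
proof -
  define S where "S n x = (\<Sum>k<n. a k * \<xi> k x)" for n x
  define b where "b m = v * ((\<Sum>k. (a k)\<^sup>2) - (\<Sum>k<m. (a k)\<^sup>2))" for m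
  have "v = (\<integral>x. (\<xi> 0 x)\<^sup>2 \<partial>M)" using orth[of 0 0] by (simp add: power2_eq_square)
  hence v0: "v \<ge> 0" by simp
  have prod: "integrable M (\<lambda>x. \<xi> j x * \<xi> k x)" for j k
    by (rule square_integrable_mult[OF \<xi> \<xi>])
  have sqS: "square_integrable M (S n)" for n
    unfolding S_def by (intro square_integrable_sum square_integrable_scale \<xi>) auto
  have lim: "AE x in M. (\<lambda>n. S n x) \<longlonglongrightarrow> W x"
    using sums unfolding S_def sums_def by simp
  have cauchy: "(\<integral>x. (S n x - S m x)\<^sup>2 \<partial>M) \<le> b m" if "m \<le> n" for m n
  proof -
    have "{..<n} - {..<m} = {m..<n}" by auto
    hence ivl: "(\<Sum>k<n. h k) - (\<Sum>k<m. h k) = (\<Sum>k\<in>{m..<n}. h k)" for h :: "nat \<Rightarrow> real"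
      using sum_diff[of "{..<n}" "{..<m}" h] that by simp
    have "(S n x - S m x)\<^sup>2 = (\<Sum>j\<in>{m..<n}. \<Sum>k\<in>{m..<n}. (a j * a k) * (\<xi> j x * \<xi> k x))" for x
      unfolding S_def ivl power2_eq_square sum_product by (intro sum.cong refl) (simp add: mult_ac)
    hence "(\<integral>x. (S n x - S m x)\<^sup>2 \<partial>M) =
          (\<integral>x. (\<Sum>j\<in>{m..<n}. \<Sum>k\<in>{m..<n}. (a j * a k) * (\<xi> j x * \<xi> k x)) \<partial>M)"
      by simp
    also have "\<dots> = (\<Sum>j\<in>{m..<n}. \<Sum>k\<in>{m..<n}. (a j * a k) * (\<integral>x. \<xi> j x * \<xi> k x \<partial>M))"
      using prod by (simp add: Bochner_Integration.integral_sum Bochner_Integration.integrable_sum)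
    also have "\<dots> = (\<Sum>j\<in>{m..<n}. v * (a j)\<^sup>2)"
    proof (intro sum.cong refl)
      fix j assume "j \<in> {m..<n}"
      have "(\<Sum>k\<in>{m..<n}. (a j * a k) * (\<integral>x. \<xi> j x * \<xi> k x \<partial>M)) =
          (\<Sum>k\<in>{m..<n}. if j = k then v * (a j)\<^sup>2 else 0)"
        unfolding orth by (intro sum.cong refl) (simp add: power2_eq_square)
      thus "(\<Sum>k\<in>{m..<n}. (a j * a k) * (\<integral>x. \<xi> j x * \<xi> k x \<partial>M)) = v * (a j)\<^sup>2"
        using \<open>j \<in> {m..<n}\<close> by simp
    qed
    also have "\<dots> = v * ((\<Sum>k<n. (a k)\<^sup>2) - (\<Sum>k<m. (a k)\<^sup>2))"
      by (simp add: ivl sum_distrib_left)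
    also have "\<dots> \<le> b m"
      unfolding b_def using v0 sum_le_suminf[OF a, of "{..<n}"] by (intro mult_left_mono) auto
    finally show ?thesis .
  qed
  have b: "b \<longlonglongrightarrow> 0"
  proof -
    have "b \<longlonglongrightarrow> v * ((\<Sum>k. (a k)\<^sup>2) - (\<Sum>k. (a k)\<^sup>2))"
      unfolding b_def by (intro tendsto_intros summable_LIMSEQ a)
    thus ?thesis by simp
  qed
  show "square_integrable M W"
    by (rule mean_square_limit(1)[where S = S and b = b, OF sqS W lim _ b]) (rule cauchy)
  show "(\<lambda>k. a k * (\<integral>x. \<xi> k x * U x \<partial>M)) sums (\<integral>x. W x * U x \<partial>M)" if U: "square_integrable M U"
  proof -
    have "(\<integral>x. S n x * U x \<partial>M) = (\<Sum>k<n. a k * (\<integral>x. \<xi> k x * U x \<partial>M))" for n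
      using square_integrable_mult[OF \<xi> U] by (simp add: S_def sum_distrib_right mult.assoc)
    moreover have "(\<lambda>n. \<integral>x. S n x * U x \<partial>M) \<longlonglongrightarrow> (\<integral>x. W x * U x \<partial>M)"
      by (rule mean_square_limit(2)[where S = S and b = b, OF sqS W lim _ b U]) (rule cauchy)
    ultimately show ?thesis by (simp add: sums_def)
  qed
qed

section \<open>Covariances of the logarithmic processes\<close>

lemma (in prob_space) square_integrable_const: "square_integrable M (\<lambda>_. c)"
  by (simp add: square_integrable_def)

lemma (in prob_space) square_integrable_integrable:
  assumes "square_integrable M f"
  shows "integrable M f"
proof -
  have "integrable M (\<lambda>x. f x * 1)"
    by (rule square_integrable_mult[OF assms square_integrable_const])
  thus ?thesis by (simp only: mult_1_right)
qed

lemma (in prob_space) has_finite_variance_iff: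
  "has_finite_variance M f \<longleftrightarrow> square_integrable M f"
proof
  assume "has_finite_variance M f"
  hence f: "integrable M f" "integrable M (\<lambda>x. (f x - expectation f)\<^sup>2)"
    by (simp_all only: has_finite_variance_def)
  have "square_integrable M (\<lambda>x. f x - expectation f)"
    unfolding square_integrable_def by (rule conjI[OF _ f(2)]) (use f(1) in measurable)
  from square_integrable_add[OF this square_integrable_const[of "expectation f"]]
  show "square_integrable M f" by simp
next
  assume *: "square_integrable M f"
  have "square_integrable M (\<lambda>x. f x - expectation f)"
    by (rule square_integrable_diff[OF * square_integrable_const])
  thus "has_finite_variance M f"
    unfolding has_finite_variance_def square_integrable_def
    by (intro conjI square_integrable_integrable[OF *]) (elim conjE)
qed

text \<open>
  One-sided sequences are extended to all integers so that shifts and reflections of the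
  summation index need no side conditions.
\<close>

definition extend0 :: "(nat \<Rightarrow> real) \<Rightarrow> int \<Rightarrow> real" where
  "extend0 a i = (if i < 0 then 0 else a (nat i))"

context sfiegarch
begin

text \<open>
  The function \<open>g\<close> itself, centred with the common mean of all the \<open>\<bar>Z\<^sub>t\<bar>\<close>, so that \<open>g(Z\<^sub>t)\<close> is one fixed
  Borel function of \<open>Z\<^sub>t\<close> for every \<open>t\<close>.
\<close>

definition news :: "real \<Rightarrow> real" where
  "news z = \<theta> * z + \<gamma> * (\<bar>z\<bar> - expectation (\<lambda>x. \<bar>Z 0 x\<bar>))"

lemma Z_measurable [measurable]: "Z t \<in> borel_measurable M"
  using Z_indep by (auto simp: indep_vars_def)

lemma news_measurable [measurable]: "news \<in> borel_measurable borel"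
  unfolding news_def by measurable

lemma expectation_Z_transform:
  assumes [measurable]: "\<phi> \<in> borel_measurable borel"
  shows "expectation (\<lambda>x. \<phi> (Z t x)) = expectation (\<lambda>x. \<phi> (Z 0 x) :: real)"
  using integral_distr[of "Z t" M borel \<phi>] integral_distr[of "Z 0" M borel \<phi>] Z_ident[of t]
  by simp

lemma square_integrable_Z_transform:
  assumes [measurable]: "\<phi> \<in> borel_measurable borel"
    and "square_integrable M (\<lambda>x. \<phi> (Z 0 x))"
  shows "square_integrable M (\<lambda>x. \<phi> (Z t x))"
proof -
  have "integrable M (\<lambda>x. (\<phi> (Z t x))\<^sup>2) \<longleftrightarrow> integrable M (\<lambda>x. (\<phi> (Z 0 x))\<^sup>2)"
    using integrable_distr_eq[of "Z t" M borel "\<lambda>z. (\<phi> z)\<^sup>2"]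
      integrable_distr_eq[of "Z 0" M borel "\<lambda>z. (\<phi> z)\<^sup>2"] Z_ident[of t] by simp
  thus ?thesis using assms(2) by (simp add: square_integrable_def)
qed

text \<open>
  For distinct indices independence factors the expectation, and the factor with mean zero
  kills it; for equal indices the common distribution reduces the claim to time 0.
\<close>

lemma Z_transform_orthogonal:
  assumes [measurable]: "\<phi> \<in> borel_measurable borel" "\<psi> \<in> borel_measurable borel"
    and \<phi>: "square_integrable M (\<lambda>x. \<phi> (Z 0 x))" and \<psi>: "square_integrable M (\<lambda>x. \<psi> (Z 0 x))"
    and zero: "expectation (\<lambda>x. \<phi> (Z 0 x)) = 0"
  shows "expectation (\<lambda>x. \<phi> (Z t x) * \<psi> (Z u x)) =
           (if t = u then expectation (\<lambda>x. \<phi> (Z 0 x) * \<psi> (Z 0 x)) else 0)"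
proof (cases "t = u")
  case True
  thus ?thesis using expectation_Z_transform[of "\<lambda>z. \<phi> z * \<psi> z" t] by simp
next
  case False
  define Y where "Y i x = (if i = t then \<phi> (Z i x) else \<psi> (Z i x))" for i x
  have "indep_vars (\<lambda>_. borel) Z {t, u}"
    by (rule indep_vars_subset[OF Z_indep]) auto
  hence "indep_vars (\<lambda>_. borel) (\<lambda>i x. (if i = t then \<phi> else \<psi>) (Z i x)) {t, u}"
    by (rule indep_vars_compose2) simp
  hence "indep_vars (\<lambda>_. borel) Y {t, u}"
    by (rule indep_vars_cong[THEN iffD1, rotated -1]) (auto simp: Y_def)
  moreover have "integrable M (Y i)" for i
    using square_integrable_integrable[OF square_integrable_Z_transform[OF _ \<phi>, of i]]
      square_integrable_integrable[OF square_integrable_Z_transform[OF _ \<psi>, of i]]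
    by (cases "i = t") (simp_all add: Y_def[abs_def])
  ultimately have "expectation (\<lambda>x. \<Prod>i\<in>{t, u}. Y i x) = (\<Prod>i\<in>{t, u}. expectation (Y i))"
    by (intro indep_vars_lebesgue_integral) auto
  moreover have "expectation (Y t) = 0"
    using expectation_Z_transform[of \<phi> t] zero by (simp add: Y_def[abs_def])
  ultimately have "expectation (\<lambda>x. Y t x * Y u x) = 0"
    using False by simp
  thus ?thesis using False by (simp add: Y_def)
qed

lemma g_proc_eq: "g_proc M \<theta> \<gamma> Z t x = news (Z t x)"
  using expectation_Z_transform[of "\<lambda>z. \<bar>z\<bar>" t] by (simp add: g_proc_def news_def)

lemma square_integrable_Z: "square_integrable M (Z t)"
  using Z_finite_variance[of t] by (simp add: has_finite_variance_iff)

lemma square_integrable_news: "square_integrable M (\<lambda>x. news (Z t x))"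
proof -
  have "square_integrable M (\<lambda>x. \<bar>Z t x\<bar>)"
    using square_integrable_Z[of t] by (simp add: square_integrable_def)
  thus ?thesis unfolding news_def
    by (intro square_integrable_add square_integrable_diff square_integrable_scale
          square_integrable_const square_integrable_Z)
qed

lemma expectation_news: "expectation (\<lambda>x. news (Z t x)) = 0"
proof -
  have "expectation (\<lambda>x. news (Z 0 x)) = 0"
    using square_integrable_integrable[OF square_integrable_Z[of 0]] Z_mean[of 0]
    by (simp add: news_def prob_space)
  thus ?thesis using expectation_Z_transform[of news t] by simp
qed

lemma variance_g_proc: "variance (g_proc M \<theta> \<gamma> Z 0) = expectation (\<lambda>x. (news (Z 0 x))\<^sup>2)"
  using expectation_news[of 0] by (simp add: g_proc_eq[abs_def])

lemma variance_g_proc': "variance (g_proc M \<theta> \<gamma> Z 0) = expectation (\<lambda>x. news (Z 0 x) * news (Z 0 x))"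
  unfolding variance_g_proc by (simp add: power2_eq_square)

lemma C1_eq:
  "cov M (g_proc M \<theta> \<gamma> Z 0) (log_sq Z 0) =
     expectation (\<lambda>x. news (Z 0 x) * (ln ((Z 0 x)\<^sup>2) - expectation (log_sq Z 0)))"
  using expectation_news[of 0] by (simp add: cov_def g_proc_eq[abs_def] log_sq_def[abs_def])

end

text \<open>
  The computation of the covariances uses of the coefficients only that they are square summable; this
  follows from \<open>d < 1/2\<close> once they are known to be a convolution.
\<close>

locale sfiegarch_l2 = sfiegarch +
  assumes coeff_l2: "summable (\<lambda>k. (sfiegarch_coeff \<alpha> \<beta> s d k)\<^sup>2)"
begin

abbreviation "lam \<equiv> sfiegarch_coeff \<alpha> \<beta> s d"
abbreviation "vg \<equiv> variance (g_proc M \<theta> \<gamma> Z 0)"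

definition "W t x = log_sq \<sigma> t x - \<omega>"

lemma W_measurable [measurable]: "W t \<in> borel_measurable M"
  using \<sigma>_rv[of t] unfolding W_def log_sq_def by measurable

lemma news_orthogonal:
  "expectation (\<lambda>x. news (Z t x) * news (Z u x)) = (if t = u then vg else 0)"
  using Z_transform_orthogonal[OF _ _ square_integrable_news square_integrable_news
      expectation_news, of t u]
  by (simp add: variance_g_proc')

lemma W_L2:
  shows square_integrable_W: "square_integrable M (W t)"
    and W_inner: "square_integrable M U \<Longrightarrow>
          (\<lambda>k. lam k * expectation (\<lambda>x. news (Z (t - 1 - int k) x) * U x)) sums
            expectation (\<lambda>x. W t x * U x)"
proof -
  have sums: "AE x in M. (\<lambda>k. lam k * news (Z (t - 1 - int k) x)) sums W t x"
    using ln_\<sigma>_sq[of t] by (simp add: g_proc_eq W_def)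
  have orth: "expectation (\<lambda>x. news (Z (t - 1 - int j) x) * news (Z (t - 1 - int k) x)) =
      (if j = k then vg else 0)" for j k
    by (subst news_orthogonal) auto
  show "square_integrable M (W t)"
    by (rule orthogonal_series(1)[OF _ orth coeff_l2 _ sums])
       (simp_all add: square_integrable_news)
  show "(\<lambda>k. lam k * expectation (\<lambda>x. news (Z (t - 1 - int k) x) * U x)) sums
          expectation (\<lambda>x. W t x * U x)" if "square_integrable M U"
    by (rule orthogonal_series(2)[OF _ orth coeff_l2 _ sums that])
       (simp_all add: square_integrable_news)
qed

lemma expectation_W: "expectation (W t) = 0"
  using W_inner[OF square_integrable_const[of 1], of t] by (simp add: expectation_news sums_unique2)

lemma expectation_log_sq_\<sigma>: "expectation (log_sq \<sigma> t) = \<omega>"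
proof -
  have "log_sq \<sigma> t = (\<lambda>x. W t x + \<omega>)" by (simp add: W_def fun_eq_iff)
  thus ?thesis
    using square_integrable_integrable[OF square_integrable_W[of t]] expectation_W[of t]
    by (simp add: prob_space)
qed

text \<open>
  Only the term of the series that carries \<open>Z\<^sub>j\<close> correlates with \<open>\<psi>(Z\<^sub>j)\<close>, and there is such a term only for
  \<open>j < t\<close>.  With \<open>\<psi> = g\<close> this gives the autocovariance of the log-volatility, with \<open>\<psi>(z) = ln(z\<^sup>2)\<close>
  (centred) the constant \<open>C\<^sub>1\<close>.
\<close>

lemma expectation_W_transform:
  assumes [measurable]: "\<psi> \<in> borel_measurable borel"
    and \<psi>: "square_integrable M (\<lambda>x. \<psi> (Z 0 x))"
  shows "expectation (\<lambda>x. W t x * \<psi> (Z j x)) =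
           extend0 lam (t - 1 - j) * expectation (\<lambda>x. news (Z 0 x) * \<psi> (Z 0 x))"
proof -
  let ?e = "expectation (\<lambda>x. news (Z 0 x) * \<psi> (Z 0 x))"
  have "(\<lambda>k. lam k * expectation (\<lambda>x. news (Z (t - 1 - int k) x) * \<psi> (Z j x))) sums
          expectation (\<lambda>x. W t x * \<psi> (Z j x))"
    by (rule W_inner, rule square_integrable_Z_transform[OF assms])
  moreover have "expectation (\<lambda>x. news (Z (t - 1 - int k) x) * \<psi> (Z j x)) =
      (if t - 1 - int k = j then ?e else 0)" for k
    by (rule Z_transform_orthogonal[OF _ _ square_integrable_news \<psi> expectation_news]) simp_all
  ultimately have 1: "(\<lambda>k. if t - 1 - int k = j then lam k * ?e else 0) sums
      expectation (\<lambda>x. W t x * \<psi> (Z j x))"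
    by (simp add: mult_delta_right)
  have "(\<lambda>k. if t - 1 - int k = j then lam k * ?e else 0) sums (extend0 lam (t - 1 - j) * ?e)"
  proof (cases "t - 1 - j < 0")
    case True
    hence "t - 1 - int k \<noteq> j" for k by auto
    thus ?thesis using True by (simp add: extend0_def)
  next
    case False
    hence "(t - 1 - int k = j) \<longleftrightarrow> (k = nat (t - 1 - j))" for k by auto
    thus ?thesis using sums_single[of "nat (t - 1 - j)" "\<lambda>k. lam k * ?e"] False
      by (simp add: extend0_def)
  qed
  from sums_unique2[OF 1 this] show ?thesis .
qed

lemma expectation_W_W:
  "(\<lambda>k. lam k * (extend0 lam (int k + (u - t)) * vg)) sums expectation (\<lambda>x. W t x * W u x)"
proof -
  have "(\<lambda>k. lam k * expectation (\<lambda>x. news (Z (t - 1 - int k) x) * W u x)) sums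
          expectation (\<lambda>x. W t x * W u x)"
    by (intro W_inner square_integrable_W)
  moreover have "expectation (\<lambda>x. news (Z j x) * W u x) = extend0 lam (u - 1 - j) * vg" for j
  proof -
    have "expectation (\<lambda>x. W u x * news (Z j x)) = extend0 lam (u - 1 - j) * vg"
      using expectation_W_transform[OF _ square_integrable_news, of u j]
      unfolding variance_g_proc' by simp
    moreover have "(\<lambda>x. news (Z j x) * W u x) = (\<lambda>x. W u x * news (Z j x))"
      by (simp add: fun_eq_iff)
    ultimately show ?thesis by (simp only:)
  qed
  ultimately show ?thesis by (simp add: algebra_simps)
qed

lemma cov_log_sq_\<sigma>: "cov M (log_sq \<sigma> t) (log_sq \<sigma> u) = expectation (\<lambda>x. W t x * W u x)"
  by (simp add: cov_def expectation_log_sq_\<sigma> W_def)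

lemma cov_log_sq_\<sigma>_shift:
  "cov M (log_sq \<sigma> (t + h)) (log_sq \<sigma> t) = cov M (log_sq \<sigma> h) (log_sq \<sigma> 0)"
  using expectation_W_W[of t "t + h"] expectation_W_W[of 0 h]
  by (simp add: cov_log_sq_\<sigma> sums_unique2)

lemma weakly_stationary_log_sq_\<sigma>: "weakly_stationary M (log_sq \<sigma>)"
proof -
  have "square_integrable M (log_sq \<sigma> t)" for t
    using square_integrable_add[OF square_integrable_W[of t] square_integrable_const[of \<omega>]]
    by (simp add: W_def)
  thus ?thesis
    by (simp add: weakly_stationary_def has_finite_variance_iff expectation_log_sq_\<sigma>
          cov_log_sq_\<sigma>_shift)
qed

context
  assumes Z_nz: "AE x in M. Z 0 x \<noteq> 0"
    and fv: "has_finite_variance M (log_sq Z 0)"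
begin

private abbreviation "\<mu> \<equiv> expectation (log_sq Z 0)"
private definition lz :: "real \<Rightarrow> real" where "lz z = ln (z\<^sup>2) - \<mu>"

private lemma lz_measurable [measurable]: "lz \<in> borel_measurable borel"
  unfolding lz_def by measurable

private lemma square_integrable_lz: "square_integrable M (\<lambda>x. lz (Z t x))"
proof -
  have "square_integrable M (\<lambda>x. lz (Z 0 x))"
    using square_integrable_diff[OF fv[unfolded has_finite_variance_iff] square_integrable_const[of \<mu>]]
    by (simp add: lz_def log_sq_def)
  thus ?thesis by (rule square_integrable_Z_transform[rotated]) simp
qed

private lemma expectation_lz: "expectation (\<lambda>x. lz (Z t x)) = 0"
proof -
  have "expectation (\<lambda>x. lz (Z 0 x)) = expectation (\<lambda>x. log_sq Z 0 x - \<mu>)"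
    by (simp add: lz_def log_sq_def)
  also have "\<dots> = 0" using fv by (simp add: has_finite_variance_def prob_space)
  finally show ?thesis using expectation_Z_transform[of lz t] by simp
qed

private lemma log_sq_X: "AE x in M. log_sq X t x = (W t x + lz (Z t x)) + (\<omega> + \<mu>)"
proof -
  have "AE z in distr M borel (Z 0). z \<noteq> 0"
    using Z_nz by (subst AE_distr_iff) auto
  hence "AE x in M. Z t x \<noteq> 0"
    unfolding Z_ident[of t, symmetric] by (subst (asm) AE_distr_iff) auto
  with X_eq[of t] \<sigma>_nz[of t] show ?thesis
    by eventually_elim (simp add: log_sq_def W_def lz_def power_mult_distrib ln_mult)
qed

private lemma log_sq_X_measurable [measurable]: "log_sq X t \<in> borel_measurable M"
  using X_rv[of t] unfolding log_sq_def by measurable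

private lemma expectation_log_sq_X: "expectation (log_sq X t) = \<omega> + \<mu>"
proof -
  have "expectation (log_sq X t) = expectation (\<lambda>x. (W t x + lz (Z t x)) + (\<omega> + \<mu>))"
    by (rule integral_cong_AE) (use log_sq_X[of t] in auto)
  thus ?thesis
    using square_integrable_integrable[OF square_integrable_W[of t]] expectation_W[of t]
      square_integrable_integrable[OF square_integrable_lz[of t]] expectation_lz[of t]
    by (simp add: prob_space)
qed

text \<open>
  Of the two mixed covariances, the one of \<open>ln(\<sigma>\<^sub>t\<^sup>2)\<close> and \<open>ln(Z\<^sub>u\<^sup>2)\<close> is nonzero only for \<open>u < t\<close>, the other only for
  \<open>t < u\<close>; for \<open>t = u\<close> both vanish.
\<close>

lemma cov_log_sq_X:
  "cov M (log_sq X t) (log_sq X u) = cov M (log_sq \<sigma> t) (log_sq \<sigma> u)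
     + cov M (g_proc M \<theta> \<gamma> Z 0) (log_sq Z 0) * (extend0 lam (t - 1 - u) + extend0 lam (u - 1 - t))
     + (if t = u then variance (log_sq Z 0) else 0)"
proof -
  let ?C = "cov M (g_proc M \<theta> \<gamma> Z 0) (log_sq Z 0)"
  have "cov M (log_sq X t) (log_sq X u) =
      expectation (\<lambda>x. (W t x + lz (Z t x)) * (W u x + lz (Z u x)))"
    unfolding cov_def expectation_log_sq_X
    by (rule integral_cong_AE) (use log_sq_X[of t] log_sq_X[of u] in \<open>auto elim!: eventually_elim2\<close>)
  also have "\<dots> = expectation (\<lambda>x. W t x * W u x) + expectation (\<lambda>x. W t x * lz (Z u x))
      + expectation (\<lambda>x. W u x * lz (Z t x)) + expectation (\<lambda>x. lz (Z t x) * lz (Z u x))"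
    by (simp add: algebra_simps square_integrable_mult square_integrable_W square_integrable_lz)
  also have "expectation (\<lambda>x. lz (Z t x) * lz (Z u x)) = (if t = u then variance (log_sq Z 0) else 0)"
    by (subst Z_transform_orthogonal[OF _ _ square_integrable_lz square_integrable_lz expectation_lz])
       (simp_all add: lz_def log_sq_def power2_eq_square)
  also have "expectation (\<lambda>x. W u x * lz (Z t x)) = extend0 lam (u - 1 - t) * ?C"
    using expectation_W_transform[OF _ square_integrable_lz, of u t] by (simp add: C1_eq lz_def)
  also have "expectation (\<lambda>x. W t x * lz (Z u x)) = extend0 lam (t - 1 - u) * ?C"
    using expectation_W_transform[OF _ square_integrable_lz, of t u] by (simp add: C1_eq lz_def)
  finally show ?thesis by (simp add: cov_log_sq_\<sigma> algebra_simps)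
qed

lemma weakly_stationary_log_sq_X: "weakly_stationary M (log_sq X)"
proof -
  have "square_integrable M (log_sq X t)" for t
  proof -
    have "square_integrable M (\<lambda>x. (W t x + lz (Z t x)) + (\<omega> + \<mu>))"
      by (intro square_integrable_add square_integrable_W square_integrable_lz square_integrable_const)
    moreover have "integrable M (\<lambda>x. (log_sq X t x)\<^sup>2) \<longleftrightarrow>
        integrable M (\<lambda>x. ((W t x + lz (Z t x)) + (\<omega> + \<mu>))\<^sup>2)"
      by (rule integrable_cong_AE) (use log_sq_X[of t] in auto)
    ultimately show ?thesis by (simp add: square_integrable_def)
  qed
  thus ?thesis
    by (simp add: weakly_stationary_def has_finite_variance_iff expectation_log_sq_X
          cov_log_sq_X cov_log_sq_\<sigma>_shift)
qed

end

end

section \<open>Gauss summation and fractional differencing coefficients\<close>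

lemma pochhammer_asymp:
  fixes a :: real
  shows "(\<lambda>n. pochhammer a (Suc n) / (fact n * real n powr a)) \<longlonglongrightarrow> rGamma a"
proof (rule Lim_transform_eventually[OF rGamma_series_LIMSEQ])
  show "\<forall>\<^sub>F n in sequentially. rGamma_series a n = pochhammer a (Suc n) / (fact n * real n powr a)"
    using eventually_gt_at_top[of 0] by eventually_elim (simp add: rGamma_series_def powr_def)
qed

text \<open>
  The terms of the hypergeometric series of \<open>a\<close>, \<open>b\<close>; \<open>c\<close> at the argument 1.
\<close>

definition gauss_term :: "real \<Rightarrow> real \<Rightarrow> real \<Rightarrow> nat \<Rightarrow> real" where
  "gauss_term a b c k = pochhammer a k * pochhammer b k / (pochhammer c k * fact k)"

lemma gauss_term_asymp:
  assumes "c > 0"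
  shows "(\<lambda>n. gauss_term a b c (Suc n) / real n powr (a + b - c - 1)) \<longlonglongrightarrow> rGamma a * rGamma b / rGamma c"
proof -
  define r where "r x n = pochhammer x (Suc n) / (fact n * real n powr x)" for x :: real and n
  have "rGamma c \<noteq> 0" using assms by (simp add: rGamma_eq_zero_iff) (metis nonpos_Ints_cases of_int_0_less_iff less_le_not_le)
  hence "(\<lambda>n. r a n * r b n / (r c n * r 1 n)) \<longlonglongrightarrow> rGamma a * rGamma b / (rGamma c * rGamma 1)"
    unfolding r_def by (intro tendsto_intros pochhammer_asymp) auto
  moreover have "\<forall>\<^sub>F n in sequentially. r a n * r b n / (r c n * r 1 n) =
      gauss_term a b c (Suc n) / real n powr (a + b - c - 1)"
    using eventually_gt_at_top[of 0]
  proof eventually_elim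
    case (elim n)
    have "pochhammer c (Suc n) > 0" using assms by (rule pochhammer_pos)
    have p: "real n powr (a + b - c - 1) = real n powr a * real n powr b / (real n powr c * real n powr 1)"
      by (simp only: powr_add powr_diff divide_divide_eq_left)
    have "real n powr x > 0" for x using elim by simp
    thus ?case
      unfolding gauss_term_def r_def p pochhammer_fact[symmetric]
      using \<open>pochhammer c (Suc n) > 0\<close>
      by (simp add: divide_simps del: pochhammer_Suc) 
  qed
  ultimately show ?thesis by (simp add: Lim_transform_eventually)
qed

lemma gauss_term_summable:
  assumes "c > 0" "a + b < c"
  shows "summable (\<lambda>k. norm (gauss_term a b c k))"
proof -
  have "(\<lambda>n. gauss_term a b c (Suc n)) \<in> O(\<lambda>n. real n powr (a + b - c - 1))"
    by (rule bigoI_tendsto[OF gauss_term_asymp]) (use assms eventually_gt_at_top[of 0] in \<open>auto elim!: eventually_mono\<close>)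
  hence "(\<lambda>n. norm (gauss_term a b c (Suc n))) \<in> O(\<lambda>n. real n powr (a + b - c - 1))"
    by (simp only: real_norm_def landau_o.big.abs_in_iff)
  moreover have "summable (\<lambda>n. norm (real n powr (a + b - c - 1)))"
    using assms by (simp add: summable_real_powr_iff)
  ultimately have "summable (\<lambda>n. norm (gauss_term a b c (Suc n)))"
    by (rule summable_comparison_test_bigo[rotated])
  thus ?thesis using summable_Suc_iff[of "\<lambda>n. norm (gauss_term a b c n)"] by simp
qed

text \<open>
  The boundary term of the telescoping sum in \<open>gauss_contiguous\<close>.
\<close>

lemma gauss_term_boundary:
  assumes "c > 0" "a + b < c"
  shows "(\<lambda>k. real k * gauss_term a b c k) \<longlonglongrightarrow> 0"
proof (rule LIMSEQ_imp_Suc)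
  define e where "e = a + b - c - 1"
  have "e < -1" using assms by (simp add: e_def)
  hence "(\<lambda>n. (real n + 1) * real n powr e) \<longlonglongrightarrow> 0" by real_asymp
  from tendsto_mult[OF this gauss_term_asymp[OF assms(1), of a b]]
  have "(\<lambda>n. (real n + 1) * real n powr e * (gauss_term a b c (Suc n) / real n powr e)) \<longlonglongrightarrow> 0"
    by (simp add: e_def)
  moreover have "\<forall>\<^sub>F n in sequentially. (real n + 1) * real n powr e * (gauss_term a b c (Suc n) / real n powr e)
      = real (Suc n) * gauss_term a b c (Suc n)"
    using eventually_gt_at_top[of 0] by eventually_elim auto
  ultimately show "(\<lambda>n. real (Suc n) * gauss_term a b c (Suc n)) \<longlonglongrightarrow> 0"
    by (rule Lim_transform_eventually)
qed

definition gauss_sum :: "real \<Rightarrow> real \<Rightarrow> real \<Rightarrow> real" where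
  "gauss_sum a b c = (\<Sum>k. gauss_term a b c k)"

lemma gauss_term_sums:
  "c > 0 \<Longrightarrow> a + b < c \<Longrightarrow> gauss_term a b c sums gauss_sum a b c"
  unfolding gauss_sum_def by (rule summable_sums, rule summable_norm_cancel, rule gauss_term_summable)

text \<open>
  The difference of the two sides telescopes: with \<open>t\<^sub>k\<close> the \<open>k\<close>-th term of the series with parameter \<open>c\<close>,
  its \<open>k\<close>-th term is \<open>c k t\<^sub>k - c (k + 1) t\<^sub>k\<^sub>+\<^sub>1\<close>.
\<close>

lemma gauss_contiguous:
  assumes c: "c > 0" and abc: "a + b < c"
  shows "c * (c - a - b) * gauss_sum a b c = (c - a) * (c - b) * gauss_sum a b (c + 1)"
proof -
  let ?t = "gauss_term a b c" and ?u = "gauss_term a b (c + 1)"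
  define D where "D k = c * (real k * ?t k)" for k
  have "(\<lambda>k. D k - D (Suc k)) sums (D 0 - c * 0)"
    unfolding D_def by (intro telescope_sums' tendsto_intros gauss_term_boundary assms)
  moreover have "D k - D (Suc k) = c * (c - a - b) * ?t k - (c - a) * (c - b) * ?u k" for k
  proof -
    have pos: "c + real k > 0" "pochhammer c k > 0" "real k + 1 > 0" "pochhammer (c + 1) k > 0"
      using c by (auto intro: pochhammer_pos)
    have "pochhammer c k * (c + real k) = c * pochhammer (c + 1) k"
      using pochhammer_rec[of c k] pochhammer_Suc[of c k] by simp
    hence P: "pochhammer (c + 1) k = pochhammer c k * (c + real k) / c" using c by (simp add: field_simps)
    have u: "?u k = c * (?t k / (c + real k))"
      unfolding gauss_term_def P using pos c by (simp add: field_simps)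
    have t: "?t (Suc k) = ?t k * ((a + real k) * (b + real k)) / ((c + real k) * (real k + 1))"
      unfolding gauss_term_def pochhammer_Suc fact_Suc using pos by (simp add: field_simps)
    have cancel: "x * (T * (A * B) / (y * x)) = A * B * (T / y)" if "x \<noteq> 0" for x y T A B :: real
      using that by simp
    have "D (Suc k) = c * ((a + real k) * (b + real k) * (?t k / (c + real k)))"
      unfolding D_def t of_nat_Suc add.commute[of 1]
      using cancel[of "real k + 1" "?t k" "a + real k" "b + real k" "c + real k"] pos by simp
    moreover have "c * (x * (w * (c + x))) - c * ((a + x) * (b + x) * w) =
        c * (c - a - b) * (w * (c + x)) - (c - a) * (c - b) * (c * w)" for x w
      by (simp add: algebra_simps)
    from this[of "real k" "?t k / (c + real k)"]
    have "c * (real k * ?t k) - c * ((a + real k) * (b + real k) * (?t k / (c + real k))) =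
        c * (c - a - b) * ?t k - (c - a) * (c - b) * (c * (?t k / (c + real k)))"
      using pos(1) by simp
    ultimately show ?thesis unfolding u by (simp only: D_def[of k])
  qed
  moreover have "(\<lambda>k. c * (c - a - b) * ?t k - (c - a) * (c - b) * ?u k) sums
      (c * (c - a - b) * gauss_sum a b c - (c - a) * (c - b) * gauss_sum a b (c + 1))"
    by (intro sums_diff sums_mult gauss_term_sums) (use assms in auto)
  ultimately show ?thesis using sums_unique2 by (fastforce simp: D_def)
qed

text \<open>
  For \<open>c \<longlonglongrightarrow> \<infinity>\<close> every term but the first tends to 0, and the terms are dominated by those for
  the initial value of \<open>c\<close>.
\<close>

lemma gauss_sum_large_c:
  assumes c: "c > 0" and abc: "a + b < c"
  shows "(\<lambda>n. gauss_sum a b (c + real n)) \<longlonglongrightarrow> 1"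
proof -
  have bound: "norm (gauss_term a b (c + real n) k) \<le> norm (gauss_term a b c k)" for n k
  proof -
    have "pochhammer c k \<le> pochhammer (c + real n) k"
      unfolding pochhammer_prod using c by (intro prod_mono) auto
    moreover have "pochhammer c k > 0" using c by (rule pochhammer_pos)
    ultimately show ?thesis unfolding gauss_term_def
      by (auto simp: abs_mult intro!: divide_left_mono mult_right_mono mult_pos_pos)
  qed
  have lim: "(\<lambda>n. gauss_term a b (c + real n) k) \<longlonglongrightarrow> (if k = 0 then 1 else 0)" for k
  proof (cases k)
    case (Suc j)
    have ge: "pochhammer (c + real n) k \<ge> (c + real n) * pochhammer c j" for n
    proof -
      have "pochhammer c j \<le> pochhammer (c + real n + 1) j"
        unfolding pochhammer_prod using c by (intro prod_mono) auto
      thus ?thesis using c by (auto simp: Suc pochhammer_rec intro!: mult_left_mono)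
    qed
    have "filterlim (\<lambda>n. c + real n) at_top sequentially"
      by (intro filterlim_tendsto_add_at_top[OF tendsto_const] filterlim_real_sequentially)
    moreover have "pochhammer c j > 0" using c by (rule pochhammer_pos)
    ultimately have "filterlim (\<lambda>n. pochhammer c j * (c + real n)) at_top sequentially"
      by (intro filterlim_tendsto_pos_mult_at_top[OF tendsto_const])
    hence "filterlim (\<lambda>n. pochhammer (c + real n) k) at_top sequentially"
      by (rule filterlim_at_top_mono) (use ge in \<open>simp add: mult.commute\<close>)
    hence "(\<lambda>n. pochhammer a k * pochhammer b k / fact k / pochhammer (c + real n) k) \<longlonglongrightarrow> 0"
      by (intro tendsto_divide_0[OF tendsto_const] filterlim_at_top_imp_at_infinity)
    thus ?thesis using Suc by (simp add: gauss_term_def mult.commute)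
  qed (simp add: gauss_term_def)
  have ev: "\<forall>\<^sub>F (k, n) in sequentially \<times>\<^sub>F sequentially.
      norm (gauss_term a b (c + real n) k) \<le> norm (gauss_term a b c k)"
    by (intro always_eventually) (auto simp only: bound split: prod.splits)
  have "(\<lambda>n. \<Sum>k. gauss_term a b (c + real n) k) \<longlonglongrightarrow> (\<Sum>k. if k = 0 then 1 else 0)"
    using tannerys_theorem[OF lim ev gauss_term_summable[OF assms] sequentially_bot] by blast
  moreover have "(\<Sum>k. if k = 0 then 1 else 0 :: real) = 1"
    using sums_unique[OF sums_single[of 0 "\<lambda>_. 1 :: real"]] by simp
  ultimately show ?thesis by (simp add: gauss_sum_def)
qed

lemma Gamma_shift_asymp:
  fixes x :: real
  assumes "x > 0"
  shows "(\<lambda>n. Gamma (x + real (Suc n)) / (fact n * real n powr x)) \<longlonglongrightarrow> 1"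
proof -
  have "Gamma x > 0" using assms by (rule Gamma_real_pos)
  have "x \<notin> \<int>\<^sub>\<le>\<^sub>0" using assms by (auto elim!: nonpos_Ints_cases)
  hence "Gamma (x + real (Suc n)) = Gamma x * pochhammer x (Suc n)" for n
    using pochhammer_Gamma[of x "Suc n"] \<open>Gamma x > 0\<close> by (simp add: field_simps del: pochhammer_Suc)
  moreover have "(\<lambda>n. Gamma x * (pochhammer x (Suc n) / (fact n * real n powr x))) \<longlonglongrightarrow> Gamma x * rGamma x"
    by (intro tendsto_intros pochhammer_asymp)
  moreover have "Gamma x * rGamma x = 1" using \<open>Gamma x > 0\<close> by (simp add: rGamma_inverse_Gamma)
  ultimately show ?thesis by simp
qed

text \<open>
  The quotient \<open>Q n\<close> of the two sides at \<open>c + n\<close> does not depend on \<open>n\<close>, by the contiguous relation and the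
  functional equation of the Gamma function, and it tends to 1 as \<open>n \<longlonglongrightarrow> \<infinity>\<close>.
\<close>

lemma gauss_summation:
  assumes "c > 0" "a + b < c" "a < c" "b < c"
  shows "gauss_sum a b c = Gamma c * Gamma (c - a - b) / (Gamma (c - a) * Gamma (c - b))"
proof -
  define Q where "Q n = gauss_sum a b (c + real n) * (Gamma (c - a + real n) * Gamma (c - b + real n))
      / (Gamma (c + real n) * Gamma (c - a - b + real n))" for n
  have step: "Q (Suc n) = Q n" for n
  proof -
    define x where "x = c + real n"
    have x: "x > 0" "a + b < x" "a < x" "b < x" using assms by (auto simp: x_def)
    have G: "Gamma (y + 1) = y * Gamma y" if "y > 0" for y :: real
    proof -
      have "y \<notin> \<int>\<^sub>\<le>\<^sub>0" using that by (auto elim!: nonpos_Ints_cases)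
      thus ?thesis by (rule Gamma_plus1)
    qed
    have S: "c + real (Suc n) = x + 1" "c - a + real (Suc n) = (x - a) + 1"
      "c - b + real (Suc n) = (x - b) + 1" "c - a - b + real (Suc n) = (x - a - b) + 1"
      "c + real n = x" "c - a + real n = x - a" "c - b + real n = x - b" "c - a - b + real n = x - a - b"
      by (simp_all add: x_def)
    have pos: "Gamma x > 0" "Gamma (x - a - b) > 0" using x by (auto intro!: Gamma_real_pos)
    have "Q (Suc n) = ((x - a) * (x - b) * gauss_sum a b (x + 1)) * (Gamma (x - a) * Gamma (x - b))
        / (x * Gamma x * ((x - a - b) * Gamma (x - a - b)))"
      unfolding Q_def S using x by (simp add: G mult_ac)
    also have "\<dots> = (x * (x - a - b) * gauss_sum a b x) * (Gamma (x - a) * Gamma (x - b))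
        / (x * Gamma x * ((x - a - b) * Gamma (x - a - b)))"
      using gauss_contiguous[OF x(1,2)] by simp
    also have "\<dots> = Q n" unfolding Q_def S using x pos by (simp add: divide_simps)
    finally show ?thesis .
  qed
  have const: "Q n = Q 0" for n by (induction n) (simp_all add: step)
  have "(\<lambda>n. Q (Suc n)) \<longlonglongrightarrow> 1"
  proof -
    define r where "r x n = Gamma (x + real (Suc n)) / (fact n * real n powr x)" for x :: real and n
    have "(\<lambda>n. gauss_sum a b (c + real (Suc n)) * (r (c - a) n * r (c - b) n / (r c n * r (c - a - b) n)))
        \<longlonglongrightarrow> 1 * (1 * 1 / (1 * 1))"
      unfolding r_def
      by (intro tendsto_intros Gamma_shift_asymp LIMSEQ_Suc gauss_sum_large_c) (use assms in auto)
    moreover have "\<forall>\<^sub>F n in sequentially. gauss_sum a b (c + real (Suc n)) *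
        (r (c - a) n * r (c - b) n / (r c n * r (c - a - b) n)) = Q (Suc n)"
      using eventually_gt_at_top[of 0]
    proof eventually_elim
      case (elim n)
      have pos: "fact n * real n powr x > 0" for x using elim by simp
      have "(fact n * real n powr (c - a)) * (fact n * real n powr (c - b)) =
          (fact n * real n powr c) * (fact n * real n powr (c - a - b))"
        by (simp add: powr_add[symmetric] mult_ac)
      hence "r (c - a) n * r (c - b) n / (r c n * r (c - a - b) n) =
          (Gamma (c - a + real (Suc n)) * Gamma (c - b + real (Suc n)))
            / (Gamma (c + real (Suc n)) * Gamma (c - a - b + real (Suc n)))"
        unfolding r_def times_divide_times_eq using pos elim by simp
      thus ?case by (simp add: Q_def)
    qed
    ultimately show ?thesis by (simp add: Lim_transform_eventually)
  qed
  moreover have "(\<lambda>n. Q (Suc n)) = (\<lambda>n. Q 0)" using const by auto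
  ultimately have "Q 0 = 1" using LIMSEQ_unique tendsto_const by metis
  moreover have "Gamma (c - a) > 0" "Gamma (c - b) > 0" "Gamma c > 0" "Gamma (c - a - b) > 0"
    using assms by (auto intro!: Gamma_real_pos)
  ultimately show ?thesis by (simp add: Q_def field_simps)
qed

lemma rGamma_diff_nat:
  fixes d :: real
  shows "rGamma (1 - d - real h) = (-1) ^ h * pochhammer d h * rGamma (1 - d)"
proof -
  have "rGamma (1 - d - real h) = pochhammer (1 - d - real h) h * rGamma (1 - d)"
    using pochhammer_rGamma[of "1 - d - real h" h] by simp
  also have "pochhammer (1 - d - real h) h = (-1) ^ h * pochhammer d h"
    using pochhammer_minus[of "d + real h - 1" h] by (simp add: algebra_simps)
  finally show ?thesis .
qed

text \<open>The Taylor coefficients at 0 of \<open>(1 - z) powr (- d)\<close>.\<close>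

definition fracdiff :: "real \<Rightarrow> nat \<Rightarrow> real" where
  "fracdiff d k = pochhammer d k / fact k"

text \<open>
  Factoring out \<open>fracdiff d h\<close> turns the sum into a hypergeometric series at 1 with parameters
  \<open>d\<close>, \<open>d + h\<close>; \<open>1 + h\<close>; the condition \<open>a + b < c\<close> of Gauss's theorem becomes \<open>d < 1/2\<close>.
\<close>

lemma fracdiff_autocorrelation:
  assumes d: "d < 1/2"
  shows "summable (\<lambda>k. norm (fracdiff d k * fracdiff d (k + h)))"
    and "(\<lambda>k. fracdiff d k * fracdiff d (k + h)) sums
      ((-1) ^ h * Gamma (1 - 2 * d) * rGamma (1 - d + real h) * rGamma (1 - d - real h))"
proof -
  let ?t = "gauss_term d (d + real h) (1 + real h)"
  have eq: "fracdiff d k * fracdiff d (k + h) = fracdiff d h * ?t k" for k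
  proof -
    have "fact (h + k) = fact h * pochhammer (1 + real h) k"
      using pochhammer_product'[of "1 :: real" h k] by (simp add: pochhammer_fact)
    moreover have "pochhammer d (h + k) = pochhammer d h * pochhammer (d + real h) k"
      by (rule pochhammer_product')
    ultimately have "fracdiff d (k + h) = fracdiff d h * pochhammer (d + real h) k / pochhammer (1 + real h) k"
      by (simp add: fracdiff_def add.commute[of k h])
    thus ?thesis by (simp add: fracdiff_def gauss_term_def mult_ac)
  qed
  have c: "1 + real h > 0" "d + (d + real h) < 1 + real h" "d < 1 + real h" "d + real h < 1 + real h"
    using d by auto
  show "summable (\<lambda>k. norm (fracdiff d k * fracdiff d (k + h)))"
    unfolding eq norm_mult by (intro summable_mult gauss_term_summable c)
  have "(\<lambda>k. fracdiff d h * ?t k) sums (fracdiff d h * gauss_sum d (d + real h) (1 + real h))"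
    by (intro sums_mult gauss_term_sums c)
  also have "gauss_sum d (d + real h) (1 + real h) =
      fact h * Gamma (1 - 2 * d) * rGamma (1 - d + real h) * rGamma (1 - d)"
  proof -
    have eqs: "1 + real h - d - (d + real h) = 1 - 2 * d" "1 + real h - d = 1 - d + real h"
      "1 + real h - (d + real h) = 1 - d" by simp_all
    have "Gamma (1 + real h) = fact h" by (simp add: Gamma_fact)
    thus ?thesis unfolding gauss_summation[OF c] eqs
      by (simp add: rGamma_inverse_Gamma divide_inverse)
  qed
  also have "fracdiff d h * (fact h * Gamma (1 - 2 * d) * rGamma (1 - d + real h) * rGamma (1 - d)) =
      (-1) ^ h * Gamma (1 - 2 * d) * rGamma (1 - d + real h) * rGamma (1 - d - real h)"
  proof -
    have "rGamma (1 - d - real h) = (-1) ^ h * pochhammer d h * rGamma (1 - d)"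
      by (rule rGamma_diff_nat)
    moreover have "(-1) ^ h * (-1) ^ h = (1 :: real)" by (simp flip: power_mult_distrib)
    ultimately show ?thesis by (simp add: fracdiff_def mult_ac) 
  qed
  finally show "(\<lambda>k. fracdiff d k * fracdiff d (k + h)) sums
      ((-1) ^ h * Gamma (1 - 2 * d) * rGamma (1 - d + real h) * rGamma (1 - d - real h))"
    unfolding eq .
qed

section \<open>Autocorrelation of a convolution\<close>

definition acorr :: "(int \<Rightarrow> real) \<Rightarrow> int \<Rightarrow> real" where
  "acorr u n = (\<Sum>\<^sub>\<infinity>i. u i * u (i + n))"

definition conv :: "(int \<Rightarrow> real) \<Rightarrow> (int \<Rightarrow> real) \<Rightarrow> int \<Rightarrow> real" where
  "conv f p i = (\<Sum>\<^sub>\<infinity>a. f a * p (i - a))"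

lemma has_sum_shift:
  fixes c :: int
  shows "((\<lambda>i. f (i + c)) has_sum x) UNIV \<longleftrightarrow> (f has_sum x) UNIV"
  by (rule has_sum_reindex_bij_witness[of _ "\<lambda>i. i - c" "\<lambda>i. i + c"]) auto

lemma summable_on_shift:
  fixes c :: int
  shows "(\<lambda>i. f (i + c)) summable_on UNIV \<longleftrightarrow> f summable_on UNIV"
  by (simp add: summable_on_def has_sum_shift)

lemma infsum_shift:
  fixes c :: int and f :: "int \<Rightarrow> real"
  shows "(\<Sum>\<^sub>\<infinity>i. f (i + c)) = (\<Sum>\<^sub>\<infinity>i. f i)"
  by (rule infsum_reindex_bij_witness[of _ "\<lambda>i. i - c" "\<lambda>i. i + c"]) auto

lemma le_infsum:
  fixes u :: "'i \<Rightarrow> real"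
  assumes "u summable_on UNIV" "\<And>i. u i \<ge> 0"
  shows "u i \<le> (\<Sum>\<^sub>\<infinity>i. u i)"
  using finite_sum_le_infsum[OF assms(1), of "{i}"] assms(2) by simp

lemma summable_on_if_abs:
  fixes u :: "'i \<Rightarrow> real"
  shows "(\<lambda>i. \<bar>u i\<bar>) summable_on A \<Longrightarrow> u summable_on A"
  using abs_summable_summable[of u A] by simp

lemma has_sum_product_abs:
  fixes f :: "'i \<Rightarrow> real" and g :: "'j \<Rightarrow> real"
  assumes f: "(\<lambda>x. \<bar>f x\<bar>) summable_on A" and g: "(\<lambda>x. \<bar>g x\<bar>) summable_on B"
  shows summable_on_product_abs: "(\<lambda>(x, y). \<bar>f x * g y\<bar>) summable_on A \<times> B"
    and "((\<lambda>(x, y). f x * g y) has_sum (infsum f A * infsum g B)) (A \<times> B)"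
proof -
  show *: "(\<lambda>(x, y). \<bar>f x * g y\<bar>) summable_on A \<times> B"
  proof (rule summable_on_SigmaI)
    show "((\<lambda>y. case (x, y) of (x, y) \<Rightarrow> \<bar>f x * g y\<bar>) has_sum (\<bar>f x\<bar> * (\<Sum>\<^sub>\<infinity>y\<in>B. \<bar>g y\<bar>))) B" for x
      unfolding abs_mult prod.case by (rule has_sum_cmult_right[OF has_sum_infsum[OF g]])
    show "(\<lambda>x. \<bar>f x\<bar> * (\<Sum>\<^sub>\<infinity>y\<in>B. \<bar>g y\<bar>)) summable_on A"
      by (rule summable_on_cmult_left[OF f])
  qed auto
  show "((\<lambda>(x, y). f x * g y) has_sum (infsum f A * infsum g B)) (A \<times> B)"
  proof (rule has_sum_SigmaI)
    show "((\<lambda>y. case (x, y) of (x, y) \<Rightarrow> f x * g y) has_sum (f x * infsum g B)) B" for x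
      unfolding prod.case by (rule has_sum_cmult_right[OF has_sum_infsum[OF summable_on_if_abs[OF g]]])
    show "((\<lambda>x. f x * infsum g B) has_sum (infsum f A * infsum g B)) A"
      by (rule has_sum_cmult_left[OF has_sum_infsum[OF summable_on_if_abs[OF f]]])
    show "(\<lambda>(x, y). f x * g y) summable_on A \<times> B"
      by (rule summable_on_if_abs) (use * in \<open>simp add: case_prod_unfold\<close>)
  qed
qed

context
  fixes f p :: "int \<Rightarrow> real"
  assumes f: "(\<lambda>i. \<bar>f i\<bar>) summable_on UNIV" and p: "(\<lambda>i. (p i)\<^sup>2) summable_on UNIV"
begin

private lemma conv_abs_summable: "(\<lambda>a. \<bar>f a * p (i - a)\<bar>) summable_on UNIV"
proof (rule summable_on_comparison_test)
  show "(\<lambda>a. \<bar>f a\<bar> * (1 + (\<Sum>\<^sub>\<infinity>i. (p i)\<^sup>2))) summable_on UNIV"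
    by (rule summable_on_cmult_left[OF f])
  show "\<bar>f a * p (i - a)\<bar> \<le> \<bar>f a\<bar> * (1 + (\<Sum>\<^sub>\<infinity>i. (p i)\<^sup>2))" for a
  proof -
    have "\<bar>p (i - a)\<bar> \<le> 1 + (p (i - a))\<^sup>2" using abs_le_squares[of 1 "p (i - a)"] by simp
    also have "\<dots> \<le> 1 + (\<Sum>\<^sub>\<infinity>i. (p i)\<^sup>2)" using le_infsum[OF p, of "i - a"] by simp
    finally show ?thesis unfolding abs_mult by (intro mult_left_mono) auto
  qed
qed simp

private lemma p_prod_summable: "(\<lambda>i. \<bar>p (i + b) * p (i + c)\<bar>) summable_on UNIV"
proof (rule summable_on_comparison_test)
  show "(\<lambda>i. (p (i + b))\<^sup>2 + (p (i + c))\<^sup>2) summable_on UNIV"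
    using p by (intro summable_on_add) (simp_all only: summable_on_shift[of "\<lambda>i. (p i)\<^sup>2"])
qed (auto intro: abs_le_squares)

private lemma p_prod_bound: "(\<Sum>\<^sub>\<infinity>i. \<bar>p (i + b) * p (i + c)\<bar>) \<le> 2 * (\<Sum>\<^sub>\<infinity>i. (p i)\<^sup>2)"
proof -
  have s: "(\<lambda>i. (p (i + b))\<^sup>2) summable_on UNIV" for b
    using p by (simp only: summable_on_shift[of "\<lambda>i. (p i)\<^sup>2"])
  have "(\<Sum>\<^sub>\<infinity>i. \<bar>p (i + b) * p (i + c)\<bar>) \<le> (\<Sum>\<^sub>\<infinity>i. (p (i + b))\<^sup>2 + (p (i + c))\<^sup>2)"
    by (intro infsum_mono p_prod_summable summable_on_add s abs_le_squares)
  also have "\<dots> = (\<Sum>\<^sub>\<infinity>i. (p (i + b))\<^sup>2) + (\<Sum>\<^sub>\<infinity>i. (p (i + c))\<^sup>2)"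
    by (intro infsum_add s)
  also have "\<dots> = 2 * (\<Sum>\<^sub>\<infinity>i. (p i)\<^sup>2)" by (simp only: infsum_shift[of "\<lambda>i. (p i)\<^sup>2"])
  finally show ?thesis .
qed

text \<open>
  The triple family behind \<open>acorr_conv\<close>: its sum over \<open>(a, b)\<close> is \<open>conv f p i * conv f p (i + n)\<close>, and its sum over
  \<open>i\<close> is \<open>f a * f b\<close> times a value of the autocorrelation of \<open>p\<close>.  It is absolutely summable since \<open>f\<close> is
  summable and the inner sums over \<open>i\<close> are bounded by the square sum of \<open>p\<close>.
\<close>

private definition h :: "int \<Rightarrow> (int \<times> int) \<times> int \<Rightarrow> real" where
  "h n = (\<lambda>((a, b), i). f a * f b * (p (i + (- a)) * p (i + (n - b))))"

private lemma h_summable: "h n summable_on (UNIV \<times> UNIV) \<times> UNIV"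
proof (rule summable_on_if_abs, rule summable_on_SigmaI)
  let ?g = "\<lambda>(a, b). \<bar>f a * f b\<bar> * (\<Sum>\<^sub>\<infinity>i. \<bar>p (i + (- a)) * p (i + (n - b))\<bar>)"
  show "((\<lambda>i. \<bar>h n (ab, i)\<bar>) has_sum ?g ab) UNIV" for ab
    unfolding h_def case_prod_beta fst_conv snd_conv abs_mult[of "f _ * f _"]
    by (rule has_sum_cmult_right[OF has_sum_infsum[OF p_prod_summable]])
  show "?g summable_on UNIV \<times> UNIV"
  proof (rule summable_on_comparison_test)
    show "(\<lambda>ab. (case ab of (a, b) \<Rightarrow> \<bar>f a * f b\<bar>) * (2 * (\<Sum>\<^sub>\<infinity>i. (p i)\<^sup>2))) summable_on UNIV \<times> UNIV"
      by (rule summable_on_cmult_left[OF summable_on_product_abs[OF f f]])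
    show "?g ab \<le> (case ab of (a, b) \<Rightarrow> \<bar>f a * f b\<bar>) * (2 * (\<Sum>\<^sub>\<infinity>i. (p i)\<^sup>2))" for ab
      unfolding case_prod_beta by (rule mult_left_mono[OF p_prod_bound]) simp
    show "0 \<le> ?g ab" for ab
      unfolding case_prod_beta by (rule mult_nonneg_nonneg[OF _ infsum_nonneg]) auto
  qed
qed simp

private lemma conv_product_has_sum:
  "((\<lambda>i. conv f p i * conv f p (i + n)) has_sum infsum (h n) ((UNIV \<times> UNIV) \<times> UNIV)) UNIV"
proof (rule has_sum_SigmaD)
  have "(h n has_sum infsum (h n) ((UNIV \<times> UNIV) \<times> UNIV)) ((UNIV \<times> UNIV) \<times> UNIV)"
    by (rule has_sum_infsum[OF h_summable])
  thus "((\<lambda>(x, y). h n (y, x)) has_sum infsum (h n) ((UNIV \<times> UNIV) \<times> UNIV)) (UNIV \<times> (UNIV \<times> UNIV))"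
    by (subst (asm) has_sum_swap)
  show "((\<lambda>y. case (i, y) of (x, y) \<Rightarrow> h n (y, x)) has_sum (conv f p i * conv f p (i + n))) (UNIV \<times> UNIV)" for i
    using has_sum_product_abs(2)[OF conv_abs_summable[of i] conv_abs_summable[of "i + n"]]
    by (simp add: h_def conv_def case_prod_unfold mult_ac add_diff_eq)
qed

lemma conv_square_summable: "(\<lambda>i. (conv f p i)\<^sup>2) summable_on UNIV"
  using conv_product_has_sum[of 0] by (auto simp: summable_on_def power2_eq_square)

text \<open>
  Summing the triple family first over \<open>i\<close>, and then over the pairs \<open>(a, b)\<close> with fixed difference
  \<open>m = b - a\<close>, produces the convolution of the two autocorrelations.
\<close>

lemma acorr_conv: "((\<lambda>m. acorr f m * acorr p (n - m)) has_sum acorr (conv f p) n) UNIV"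
proof -
  let ?S = "infsum (h n) ((UNIV \<times> UNIV) \<times> UNIV)"
  have S: "acorr (conv f p) n = ?S"
    unfolding acorr_def by (rule infsumI[OF conv_product_has_sum])
  have "((\<lambda>(a, b). f a * f b * acorr p (n - (b - a))) has_sum ?S) (UNIV \<times> UNIV)"
  proof (rule has_sum_SigmaD[OF has_sum_infsum[OF h_summable]])
    show "((\<lambda>i. h n (ab, i)) has_sum (case ab of (a, b) \<Rightarrow> f a * f b * acorr p (n - (b - a)))) UNIV" for ab
    proof (cases ab)
      case (Pair a b)
      have "(\<lambda>i. p (i + (-a)) * p (i + (n - b))) summable_on UNIV"
        by (rule summable_on_if_abs[OF p_prod_summable])
      moreover have "(\<Sum>\<^sub>\<infinity>i. p (i + (-a)) * p (i + (n - b))) = acorr p (n - (b - a))"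
        using infsum_shift[of "\<lambda>i. p i * p (i + (n - (b - a)))" "-a"]
        by (simp add: acorr_def algebra_simps)
      ultimately have "((\<lambda>i. p (i + (-a)) * p (i + (n - b))) has_sum acorr p (n - (b - a))) UNIV"
        by (metis has_sum_infsum)
      thus ?thesis unfolding Pair h_def prod.case by (rule has_sum_cmult_right)
    qed
  qed
  also have "?this \<longleftrightarrow> ((\<lambda>(m, a). f a * f (a + m) * acorr p (n - m)) has_sum ?S) (UNIV \<times> UNIV)"
    by (rule has_sum_reindex_bij_witness[of _ "\<lambda>(m, a). (a, a + m)" "\<lambda>(a, b). (b - a, a)"]) auto
  finally have *: "((\<lambda>(m, a). f a * f (a + m) * acorr p (n - m)) has_sum ?S) (UNIV \<times> UNIV)" .
  show ?thesis unfolding S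
  proof (rule has_sum_SigmaD[OF *])
    fix m :: int
    have "(\<lambda>a. \<bar>f a * f (a + m)\<bar>) summable_on UNIV"
    proof (rule summable_on_comparison_test)
      show "(\<lambda>a. \<bar>f a\<bar> * (\<Sum>\<^sub>\<infinity>i. \<bar>f i\<bar>)) summable_on UNIV"
        by (rule summable_on_cmult_left[OF f])
      show "\<bar>f a * f (a + m)\<bar> \<le> \<bar>f a\<bar> * (\<Sum>\<^sub>\<infinity>i. \<bar>f i\<bar>)" for a
        unfolding abs_mult by (intro mult_left_mono le_infsum[OF f]) auto
    qed simp
    from has_sum_infsum[OF summable_on_if_abs[OF this]]
    have "((\<lambda>a. f a * f (a + m)) has_sum acorr f m) UNIV"
      unfolding acorr_def .
    from has_sum_cmult_left[OF this]
    show "((\<lambda>a. case (m, a) of (m, a) \<Rightarrow> f a * f (a + m) * acorr p (n - m))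
        has_sum (acorr f m * acorr p (n - m))) UNIV" by simp
  qed
qed

end

lemma acorr_uminus: "acorr u (- n) = acorr u n"
  unfolding acorr_def using infsum_shift[of "\<lambda>i. u i * u (i + (-n))" n] by (simp add: mult.commute)

lemma has_sum_extend0:
  fixes w :: "int \<Rightarrow> real"
  shows "((\<lambda>i. extend0 a i * w i) has_sum x) UNIV \<longleftrightarrow> ((\<lambda>k. a k * w (int k)) has_sum x) UNIV"
proof -
  have "((\<lambda>i. extend0 a i * w i) has_sum x) UNIV \<longleftrightarrow> ((\<lambda>i. extend0 a i * w i) has_sum x) (range int)"
  proof (rule has_sum_cong_neutral)
    fix i assume "i \<in> UNIV - range int"
    hence "i < 0" using rangeI[of int "nat i"] by (cases "i < 0") auto
    thus "extend0 a i * w i = 0" by (simp add: extend0_def)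
  qed auto
  also have "\<dots> \<longleftrightarrow> ((\<lambda>k. a k * w (int k)) has_sum x) UNIV"
    by (subst has_sum_reindex) (auto simp: o_def extend0_def inj_on_def)
  finally show ?thesis .
qed

lemma acorr_extend0:
  assumes "summable (\<lambda>k. norm (a k * a (k + n)))"
  shows "(\<lambda>k. a k * a (k + n)) sums acorr (extend0 a) (int n)"
proof -
  have "((\<lambda>k. a k * a (k + n)) has_sum (\<Sum>k. a k * a (k + n))) UNIV"
    by (rule norm_summable_imp_has_sum[OF assms summable_sums[OF summable_norm_cancel[OF assms]]])
  hence "((\<lambda>i. extend0 a i * extend0 a (i + int n)) has_sum (\<Sum>k. a k * a (k + n))) UNIV"
    unfolding has_sum_extend0 by (simp add: extend0_def nat_add_distrib)
  hence "acorr (extend0 a) (int n) = (\<Sum>k. a k * a (k + n))"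
    unfolding acorr_def by (rule infsumI)
  thus ?thesis using summable_sums[OF summable_norm_cancel[OF assms]] by simp
qed

section \<open>The coefficients of the filter\<close>

lemma arma_holomorphic_larger_ball:
  assumes nz: "\<And>z. norm z \<le> 1 \<Longrightarrow> cpoly \<beta> z \<noteq> 0"
  obtains R where "R > 1" "(\<lambda>z. cpoly \<alpha> z / cpoly \<beta> z) holomorphic_on ball 0 R"
proof -
  define Z where "Z = {z. cpoly \<beta> z = 0}"
  have "map_poly complex_of_real \<beta> \<noteq> 0" using nz[of 0] by (auto simp: cpoly_def)
  hence fin: "finite Z" unfolding Z_def cpoly_def by (rule poly_roots_finite)
  define R where "R = Min (insert 2 (norm ` Z))"
  have "norm z > 1" if "z \<in> Z" for z using nz[of z] that by (force simp: Z_def)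
  hence "R > 1" unfolding R_def using fin by (subst Min_gr_iff) auto
  moreover have "z \<notin> Z" if "norm z < R" for z
  proof
    assume "z \<in> Z"
    hence "R \<le> norm z" unfolding R_def using fin by (intro Min_le) auto
    thus False using that by simp
  qed
  hence "(\<lambda>z. cpoly \<alpha> z / cpoly \<beta> z) holomorphic_on ball 0 R"
    by (intro holomorphic_intros cpoly_holomorphic) (auto simp: Z_def)
  ultimately show ?thesis by (rule that)
qed

text \<open>
  The power series converges on a disc of radius greater than 1.  Convergence at a point \<open>x > 1\<close> bounds the
  coefficients by a multiple of \<open>(1/x)\<^sup>k\<close>, and convergence at 1 gives their sum.
\<close>

lemma arma_coeff_geometric:
  assumes nz: "\<And>z. norm z \<le> 1 \<Longrightarrow> cpoly \<beta> z \<noteq> 0"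
  shows "\<exists>C \<rho>. 0 < \<rho> \<and> \<rho> < 1 \<and> (\<forall>k. \<bar>arma_coeff \<alpha> \<beta> k\<bar> \<le> C * \<rho> ^ k)"
    and "arma_coeff \<alpha> \<beta> sums (poly \<alpha> 1 / poly \<beta> 1)"
proof -
  let ?F = "\<lambda>z. cpoly \<alpha> z / cpoly \<beta> z"
  obtain R where R: "R > 1" and hol: "?F holomorphic_on ball 0 R"
    using arma_holomorphic_larger_ball[OF nz] by blast
  define c where "c n = (deriv ^^ n) ?F 0 / fact n" for n
  have ac: "arma_coeff \<alpha> \<beta> n = Re (c n)" for n
    by (simp add: arma_coeff_def real_taylor_coeff_def fps_expansion_def c_def)
  have sums: "(\<lambda>n. c n * w ^ n) sums ?F w" if "norm w < R" for w
    using holomorphic_power_series[OF hol, of w] that by (simp add: c_def)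
  define x where "x = (1 + R) / 2"
  have x: "1 < x" "x < R" using R by (auto simp: x_def)
  have "summable (\<lambda>n. c n * of_real x ^ n)"
    using sums[of "of_real x"] x by (auto simp: sums_iff)
  hence "Bseq (\<lambda>n. c n * of_real x ^ n)"
    by (intro convergent_imp_Bseq convergentI[OF summable_LIMSEQ_zero])
  then obtain C where C: "norm (c n * of_real x ^ n) \<le> C" for n unfolding Bseq_def by blast
  have "\<bar>arma_coeff \<alpha> \<beta> n\<bar> \<le> C * (1 / x) ^ n" for n
  proof -
    have "\<bar>arma_coeff \<alpha> \<beta> n\<bar> \<le> norm (c n)" unfolding ac by (rule abs_Re_le_cmod)
    also have "\<dots> = norm (c n * of_real x ^ n) / x ^ n" using x by (simp add: norm_mult norm_power)
    also have "\<dots> \<le> C / x ^ n" using x C by (intro divide_right_mono) auto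
    finally show ?thesis by (simp add: power_one_over field_simps)
  qed
  moreover have "0 < 1 / x" "1 / x < 1" using x by auto
  ultimately show "\<exists>C \<rho>. 0 < \<rho> \<and> \<rho> < 1 \<and> (\<forall>k. \<bar>arma_coeff \<alpha> \<beta> k\<bar> \<le> C * \<rho> ^ k)" by blast
  have one: "cpoly p 1 = of_real (poly p 1)" for p
    unfolding cpoly_def by (induction p) (auto simp: map_poly_pCons)
  have "c sums of_real (poly \<alpha> 1 / poly \<beta> 1)"
    using sums[of 1] R by (simp add: one)
  from sums_Re[OF this] show "arma_coeff \<alpha> \<beta> sums (poly \<alpha> 1 / poly \<beta> 1)"
    by (simp add: ac[abs_def])
qed

text \<open>
  The coefficients are defined as real parts of Taylor coefficients of three different functions.
  Uniqueness of power series expansions on the disc connects them.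
\<close>

lemma sfiegarch_coeff_cauchy_product:
  assumes s: "s \<ge> 1" and nz: "\<And>z. norm z \<le> 1 \<Longrightarrow> cpoly \<beta> z \<noteq> 0"
  shows "sfiegarch_coeff \<alpha> \<beta> s d n = (\<Sum>i\<le>n. arma_coeff \<alpha> \<beta> i * frac_coeff s d (n - i))"
proof -
  have ev: "eventually (\<lambda>z::complex. norm z < 1) (nhds 0)"
    using eventually_nhds_in_open[of "ball 0 1" "0::complex"] by simp
  define A B L :: "complex fps"
    where "A = Abs_fps (\<lambda>k. of_real (arma_coeff \<alpha> \<beta> k))"
      and "B = Abs_fps (\<lambda>k. of_real (frac_coeff s d k))"
      and "L = Abs_fps (\<lambda>k. of_real (sfiegarch_coeff \<alpha> \<beta> s d k))"
  have "(\<lambda>z. cpoly \<alpha> z / cpoly \<beta> z) has_fps_expansion A"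
    by (rule has_fps_expansionI, use ev in eventually_elim)
       (simp add: A_def B_def L_def arma_coeff_sums[OF nz])
  moreover have "(\<lambda>z. (1 - z ^ s) powr (- of_real d)) has_fps_expansion B"
    by (rule has_fps_expansionI, use ev in eventually_elim)
       (simp add: A_def B_def L_def frac_coeff_sums[OF s])
  ultimately have "(\<lambda>z. cpoly \<alpha> z / cpoly \<beta> z * (1 - z ^ s) powr (- of_real d)) has_fps_expansion A * B"
    by (rule has_fps_expansion_mult)
  moreover have "(\<lambda>z. cpoly \<alpha> z / cpoly \<beta> z * (1 - z ^ s) powr (- of_real d)) has_fps_expansion L"
    by (rule has_fps_expansionI, use ev in eventually_elim)
       (simp only: A_def B_def L_def fps_nth_Abs_fps sfiegarch_coeff_sums[OF s nz])
  ultimately have "A * B = L" by (rule fps_expansion_unique_complex)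
  hence "complex_of_real (sfiegarch_coeff \<alpha> \<beta> s d n) =
      of_real (\<Sum>i\<le>n. arma_coeff \<alpha> \<beta> i * frac_coeff s d (n - i))"
    using fps_mult_nth[of A B n] by (simp add: A_def B_def L_def atLeast0AtMost)
  thus ?thesis by (simp only: of_real_eq_iff)
qed

lemma extend0_cauchy_product:
  assumes "\<And>n. l n = (\<Sum>i\<le>n. a i * b (n - i))"
  shows "((\<lambda>j. extend0 a j * extend0 b (i - j)) has_sum extend0 l i) UNIV"
  unfolding has_sum_extend0
proof (cases "i < 0")
  case True
  hence "extend0 l i = 0" "\<And>k. a k * extend0 b (i - int k) = 0" by (simp_all add: extend0_def)
  thus "((\<lambda>k. a k * extend0 b (i - int k)) has_sum extend0 l i) UNIV" by (simp only: has_sum_0)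
next
  case False
  then obtain n where i: "i = int n" by (metis not_less nonneg_int_cases)
  have "((\<lambda>k. a k * b (n - k)) has_sum (\<Sum>i\<le>n. a i * b (n - i))) {..n}"
    by (rule has_sum_finite) simp
  also have "?this \<longleftrightarrow> ((\<lambda>k. a k * extend0 b (i - int k)) has_sum (\<Sum>i\<le>n. a i * b (n - i))) UNIV"
    by (rule has_sum_cong_neutral) (auto simp: i extend0_def nat_diff_distrib)
  finally show "((\<lambda>k. a k * extend0 b (i - int k)) has_sum extend0 l i) UNIV"
    by (simp add: i extend0_def assms)
qed

lemma extend0_abs_summable:
  assumes "summable (\<lambda>k. \<bar>a k\<bar>)"
  shows "(\<lambda>i. \<bar>extend0 a i\<bar>) summable_on UNIV"
proof -
  have "((\<lambda>k. \<bar>a k\<bar> * 1) has_sum (\<Sum>k. \<bar>a k\<bar>)) UNIV"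
    using norm_summable_imp_has_sum[of "\<lambda>k. \<bar>a k\<bar>", OF _ summable_sums[OF assms]] assms by simp
  hence "((\<lambda>i. extend0 (\<lambda>k. \<bar>a k\<bar>) i * 1) has_sum (\<Sum>k. \<bar>a k\<bar>)) UNIV"
    by (subst has_sum_extend0)
  moreover have "extend0 (\<lambda>k. \<bar>a k\<bar>) i * 1 = \<bar>extend0 a i\<bar>" for i by (simp add: extend0_def)
  ultimately show ?thesis by (auto simp: summable_on_def)
qed

lemma extend0_has_sum:
  assumes "summable (\<lambda>k. \<bar>a k\<bar>)" "a sums x"
  shows "(extend0 a has_sum x) UNIV"
  using norm_summable_imp_has_sum[of a x] assms has_sum_extend0[of a "\<lambda>_. 1" x] by simp

lemma extend0_square_summable:
  "(\<lambda>i. (extend0 a i)\<^sup>2) summable_on UNIV \<longleftrightarrow> (\<lambda>k. (a k)\<^sup>2) summable_on UNIV"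
  using has_sum_extend0[of a "extend0 a"]
  by (simp add: summable_on_def power2_eq_square extend0_def[of _ "int _"])

lemma frac_coeff_multiple:
  assumes "s \<ge> 1"
  shows "frac_coeff s d (s * k) = fracdiff d k"
  using assms by (simp add: frac_coeff_eq fracdiff_def)

lemma frac_coeff_has_sum:
  assumes s: "s \<ge> 1"
  shows "((\<lambda>k. frac_coeff s d k * w k) has_sum x) UNIV \<longleftrightarrow>
         ((\<lambda>k. fracdiff d k * w (s * k)) has_sum (x :: real)) UNIV"
proof -
  have "((\<lambda>k. frac_coeff s d k * w k) has_sum x) UNIV \<longleftrightarrow>
        ((\<lambda>k. frac_coeff s d k * w k) has_sum x) (range (\<lambda>k. s * k))"
    by (rule has_sum_cong_neutral) (auto simp: frac_coeff_eq[OF s] dvd_def)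
  also have "\<dots> \<longleftrightarrow> ((\<lambda>k. fracdiff d k * w (s * k)) has_sum x) UNIV"
    using s by (subst has_sum_reindex) (auto simp: o_def frac_coeff_multiple inj_on_def)
  finally show ?thesis .
qed

lemma frac_coeff_square_summable:
  assumes s: "s \<ge> 1" and d: "d < 1/2"
  shows "(\<lambda>k. (frac_coeff s d k)\<^sup>2) summable_on UNIV"
proof -
  have "((\<lambda>k. fracdiff d k * fracdiff d (k + 0)) has_sum
      ((-1) ^ 0 * Gamma (1 - 2 * d) * rGamma (1 - d + real 0) * rGamma (1 - d - real 0))) UNIV"
    by (rule norm_summable_imp_has_sum[OF fracdiff_autocorrelation[OF d]])
  thus ?thesis
    using frac_coeff_has_sum[OF s, of d "frac_coeff s d"]
    by (auto simp: summable_on_def power2_eq_square frac_coeff_multiple[OF s])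
qed

lemma gamma_V_uminus: "gamma_V s d v (- n) = gamma_V s d v n"
proof (cases "int s dvd n")
  case True
  then obtain h where n: "n = int s * h" by blast
  show ?thesis
  proof (cases "s = 0")
    case False
    have "- n div int s = - h" "n div int s = h" using False by (simp_all add: n flip: mult_minus_right)
    thus ?thesis using True
      by (simp add: gamma_V_def power_int_minus_one_minus Let_def)
  qed (use n in simp)
qed (simp add: gamma_V_def)

text \<open>
  At lags that are multiples of \<open>s\<close> the sum reduces to the autocorrelation of \<open>fracdiff d\<close>; at all other lags
  one factor of every summand vanishes, in agreement with the value 0 of \<^const>\<open>gamma_V\<close>.
\<close>

lemma acorr_frac_coeff:
  assumes s: "s \<ge> 1" and d: "d < 1/2"
  shows "v * acorr (extend0 (frac_coeff s d)) n = gamma_V s d v n"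
proof -
  have *: "v * acorr (extend0 (frac_coeff s d)) (int m) = gamma_V s d v (int m)" for m
  proof (cases "s dvd m")
    case True
    then obtain h where m: "m = s * h" by blast
    let ?x = "(-1) ^ h * Gamma (1 - 2 * d) * rGamma (1 - d + real h) * rGamma (1 - d - real h)"
    have "((\<lambda>k. fracdiff d k * fracdiff d (k + h)) has_sum ?x) UNIV"
      by (rule norm_summable_imp_has_sum[OF fracdiff_autocorrelation[OF d]])
    also have "(\<lambda>k. fracdiff d k * fracdiff d (k + h)) = (\<lambda>k. fracdiff d k * frac_coeff s d (s * k + m))"
      by (simp add: m frac_coeff_multiple[OF s] flip: distrib_left)
    finally have "((\<lambda>k. frac_coeff s d k * frac_coeff s d (k + m)) has_sum ?x) UNIV"
      by (subst frac_coeff_has_sum[OF s])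
    hence "((\<lambda>i. extend0 (frac_coeff s d) i * extend0 (frac_coeff s d) (i + int m)) has_sum ?x) UNIV"
      by (subst has_sum_extend0) (simp add: extend0_def nat_add_distrib)
    hence "acorr (extend0 (frac_coeff s d)) (int m) = ?x" unfolding acorr_def by (rule infsumI)
    thus ?thesis using s by (simp add: gamma_V_def m)
  next
    case False
    have "extend0 (frac_coeff s d) i * extend0 (frac_coeff s d) (i + int m) = 0" for i
    proof (rule ccontr)
      assume nz: "\<not> ?thesis"
      hence "i \<ge> 0" by (auto simp: extend0_def split: if_splits)
      then obtain k where k: "i = int k" by (metis nonneg_int_cases)
      have "s dvd k" "s dvd (k + m)" using nz
        by (auto simp: k extend0_def nat_add_distrib frac_coeff_eq[OF s] split: if_splits)
      thus False using False by (metis dvd_add_right_iff)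
    qed
    hence "acorr (extend0 (frac_coeff s d)) (int m) = 0" unfolding acorr_def by (rule infsum_0)
    thus ?thesis using False by (simp add: gamma_V_def)
  qed
  show ?thesis
  proof (cases "n \<ge> 0")
    case True
    thus ?thesis using *[of "nat n"] by simp
  next
    case False
    thus ?thesis using *[of "nat (- n)"] acorr_uminus[of _ n] gamma_V_uminus[of s d v n] by simp
  qed
qed

lemma gamma_A_acorr:
  assumes "summable (\<lambda>k. \<bar>arma_coeff \<alpha> \<beta> k\<bar>)"
  shows "gamma_A \<alpha> \<beta> n = acorr (extend0 (arma_coeff \<alpha> \<beta>)) n"
proof -
  let ?f = "arma_coeff \<alpha> \<beta>"
  have "gamma_A \<alpha> \<beta> n = acorr (extend0 ?f) (int (nat \<bar>n\<bar>))"
  proof -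
    have "summable (\<lambda>k. norm (?f k * ?f (k + nat \<bar>n\<bar>)))"
    proof (rule summable_comparison_test_ev)
      have "?f \<longlonglongrightarrow> 0" by (rule summable_LIMSEQ_zero, rule summable_rabs_cancel, rule assms)
      hence "\<forall>\<^sub>F k in sequentially. \<bar>?f k\<bar> < 1"
        using order_tendstoD(2)[OF tendsto_rabs_zero, of ?f sequentially 1] by simp
      hence "\<forall>\<^sub>F k in sequentially. \<bar>?f (k + nat \<bar>n\<bar>)\<bar> < 1"
        by (subst eventually_sequentially_seg[of "\<lambda>k. \<bar>?f k\<bar> < 1"])
      thus "\<forall>\<^sub>F k in sequentially. norm (norm (?f k * ?f (k + nat \<bar>n\<bar>))) \<le> \<bar>?f k\<bar>"
        by eventually_elim (simp add: abs_mult mult_left_le)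
    qed (rule assms)
    from sums_unique[OF acorr_extend0[OF this]] show ?thesis by (simp add: gamma_A_def)
  qed
  thus ?thesis using acorr_uminus[of "extend0 ?f" n] by (cases "n \<ge> 0") auto
qed

context sfiegarch
begin

lemma arma_abs_summable: "summable (\<lambda>k. \<bar>arma_coeff \<alpha> \<beta> k\<bar>)"
proof -
  obtain C \<rho> where "0 < \<rho>" "\<rho> < 1" and C: "\<And>k. \<bar>arma_coeff \<alpha> \<beta> k\<bar> \<le> C * \<rho> ^ k"
    using arma_coeff_geometric(1)[OF \<beta>_nz] by blast
  show ?thesis
    by (rule summable_comparison_test_ev[where g = "\<lambda>k. C * \<rho> ^ k"])
       (use C \<open>0 < \<rho>\<close> \<open>\<rho> < 1\<close> in \<open>auto intro!: summable_mult summable_geometric\<close>)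
qed

lemma coeff_convolution:
  "((\<lambda>j. extend0 (arma_coeff \<alpha> \<beta>) j * extend0 (frac_coeff s d) (i - j)) has_sum
      extend0 (sfiegarch_coeff \<alpha> \<beta> s d) i) UNIV"
  by (rule extend0_cauchy_product, rule sfiegarch_coeff_cauchy_product[OF s_ge_1 \<beta>_nz])

lemma coeff_conv:
  "conv (extend0 (arma_coeff \<alpha> \<beta>)) (extend0 (frac_coeff s d)) = extend0 (sfiegarch_coeff \<alpha> \<beta> s d)"
  unfolding conv_def fun_eq_iff by (intro allI infsumI coeff_convolution)

lemma sfiegarch_l2:
  assumes d: "d < 1/2"
  shows "sfiegarch_l2 M p d q s \<omega> \<theta> \<gamma> \<alpha> \<beta> Z \<sigma> X"
proof unfold_locales
  have "(\<lambda>i. (extend0 (sfiegarch_coeff \<alpha> \<beta> s d) i)\<^sup>2) summable_on UNIV"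
    unfolding coeff_conv[symmetric]
    by (intro conv_square_summable extend0_abs_summable arma_abs_summable
          extend0_square_summable[THEN iffD2] frac_coeff_square_summable s_ge_1 d)
  thus "summable (\<lambda>k. (sfiegarch_coeff \<alpha> \<beta> s d k)\<^sup>2)"
    unfolding extend0_square_summable by (auto simp: summable_on_def sums_iff dest!: has_sum_imp_sums)
qed

end

context sfiegarch_l2
begin

lemma autocov_log_sq_\<sigma>_acorr: "autocov M (log_sq \<sigma>) h = vg * acorr (extend0 lam) h"
proof -
  have sq: "(\<lambda>k. (lam k)\<^sup>2) summable_on UNIV"
    using coeff_l2 by (intro norm_summable_imp_summable_on) simp
  hence ext: "(\<lambda>i. (extend0 lam i)\<^sup>2) summable_on UNIV"
    by (simp add: extend0_square_summable)
  have "(\<lambda>i. extend0 lam i * extend0 lam (i + - h)) summable_on UNIV"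
  proof (rule summable_on_if_abs, rule summable_on_comparison_test)
    show "(\<lambda>i. (extend0 lam i)\<^sup>2 + (extend0 lam (i + - h))\<^sup>2) summable_on UNIV"
      by (intro summable_on_add ext summable_on_shift[of "\<lambda>i. (extend0 lam i)\<^sup>2", THEN iffD2])
  qed (simp_all only: abs_le_squares abs_ge_zero)
  hence "((\<lambda>i. extend0 lam i * extend0 lam (i + - h)) has_sum acorr (extend0 lam) (- h)) UNIV"
    unfolding acorr_def by (rule has_sum_infsum)
  hence "(\<lambda>k. lam k * extend0 lam (int k + - h)) sums acorr (extend0 lam) (- h)"
    unfolding has_sum_extend0 by (rule has_sum_imp_sums)
  hence "(\<lambda>k. lam k * extend0 lam (int k + - h) * vg) sums (acorr (extend0 lam) (- h) * vg)"
    by (rule sums_mult2)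
  moreover have "(\<lambda>k. lam k * extend0 lam (int k + - h) * vg) sums autocov M (log_sq \<sigma>) h"
    using expectation_W_W[of 0 h] by (simp add: autocov_def cov_log_sq_\<sigma> mult.assoc)
  ultimately have "acorr (extend0 lam) (- h) * vg = autocov M (log_sq \<sigma>) h"
    by (rule sums_unique2)
  thus ?thesis unfolding acorr_uminus by (simp only: mult.commute)
qed

lemma autocov_log_sq_\<sigma>_has_sum:
  assumes d: "d < 1/2"
  shows "((\<lambda>m. gamma_A \<alpha> \<beta> m * gamma_V s d vg (n - m)) has_sum autocov M (log_sq \<sigma>) n) UNIV"
proof -
  let ?f = "extend0 (arma_coeff \<alpha> \<beta>)" and ?p = "extend0 (frac_coeff s d)"
  have "((\<lambda>m. acorr ?f m * acorr ?p (n - m)) has_sum acorr (conv ?f ?p) n) UNIV"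
    by (intro acorr_conv extend0_abs_summable arma_abs_summable
          extend0_square_summable[THEN iffD2] frac_coeff_square_summable s_ge_1 d)
  from has_sum_cmult_right[OF this, of vg] show ?thesis
    by (simp add: gamma_A_acorr[OF arma_abs_summable] acorr_frac_coeff[OF s_ge_1 d, symmetric]
          coeff_conv autocov_log_sq_\<sigma>_acorr mult_ac)
qed

end

section \<open>Smoothing by geometrically decaying sequences\<close>

lemma geometric_summable_on_int:
  fixes \<rho> :: real
  assumes "0 < \<rho>" "\<rho> < 1"
  shows "(\<lambda>k::int. \<rho> ^ nat \<bar>k\<bar>) summable_on UNIV"
proof -
  have geo: "(\<lambda>k. \<rho> ^ k) summable_on UNIV"
    by (rule norm_summable_imp_summable_on) (use assms in \<open>simp add: summable_geometric\<close>)
  have "(\<lambda>k::int. \<rho> ^ nat \<bar>k\<bar>) summable_on range int"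
    by (subst summable_on_reindex) (use geo in \<open>auto simp: o_def inj_on_def\<close>)
  moreover have "(\<lambda>k::int. \<rho> ^ nat \<bar>k\<bar>) summable_on range (\<lambda>n. - int (Suc n))"
  proof (subst summable_on_reindex)
    have "(\<lambda>k. \<rho> ^ k * \<rho>) summable_on UNIV" by (rule summable_on_cmult_left[OF geo])
    moreover have "nat (int k + 1) = Suc k" for k by simp
    ultimately show "((\<lambda>k::int. \<rho> ^ nat \<bar>k\<bar>) \<circ> (\<lambda>n. - int (Suc n))) summable_on UNIV"
      by (simp add: o_def mult.commute)
  qed (auto simp: inj_on_def)
  ultimately have "(\<lambda>k::int. \<rho> ^ nat \<bar>k\<bar>) summable_on range int \<union> range (\<lambda>n. - int (Suc n))"
    by (rule summable_on_Un_disjoint) auto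
  moreover have "k \<in> range int \<union> range (\<lambda>n. - int (Suc n))" for k
  proof (cases "k \<ge> 0")
    case True
    thus ?thesis using rangeI[of int "nat k"] by simp
  next
    case False
    thus ?thesis using rangeI[of "\<lambda>n. - int (Suc n)" "nat (- k - 1)"] by simp
  qed
  hence "range int \<union> range (\<lambda>n. - int (Suc n)) = UNIV" by auto
  ultimately show ?thesis by simp
qed

text \<open>
  An enumeration of the integers transports Tannery's theorem from series to sums over the integers.
\<close>

lemma infsum_int_decode:
  fixes f :: "int \<Rightarrow> real"
  assumes "(\<lambda>k. \<bar>f k\<bar>) summable_on UNIV"
  shows "(\<Sum>\<^sub>\<infinity>k. f k) = (\<Sum>n. f (int_decode n))"
proof -
  have "(\<lambda>n. \<bar>f (int_decode n)\<bar>) summable_on UNIV"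
    using assms summable_on_reindex_bij_betw[OF bij_int_decode, of "\<lambda>k. \<bar>f k\<bar>"] by simp
  hence "summable (\<lambda>n. \<bar>f (int_decode n)\<bar>)" by (rule summable_on_imp_summable)
  hence "((\<lambda>n. f (int_decode n)) has_sum (\<Sum>n. f (int_decode n))) UNIV"
    by (intro norm_summable_imp_has_sum summable_sums) (auto dest: summable_rabs_cancel)
  hence "(\<Sum>\<^sub>\<infinity>n. f (int_decode n)) = (\<Sum>n. f (int_decode n))" by (rule infsumI)
  thus ?thesis by (simp add: infsum_reindex_bij_betw[OF bij_int_decode])
qed

lemma tannery_int:
  fixes t :: "int \<Rightarrow> nat \<Rightarrow> real"
  assumes lim: "\<And>k. t k \<longlonglongrightarrow> L k"
    and bound: "\<forall>\<^sub>F h in sequentially. \<forall>k. \<bar>t k h\<bar> \<le> m k"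
    and m: "m summable_on UNIV"
  shows "(\<lambda>h. \<Sum>\<^sub>\<infinity>k. t k h) \<longlonglongrightarrow> (\<Sum>\<^sub>\<infinity>k. L k)"
proof -
  have "(\<lambda>n. m (int_decode n)) summable_on UNIV"
    using m summable_on_reindex_bij_betw[OF bij_int_decode, of m] by simp
  hence summ: "summable (\<lambda>n. m (int_decode n))" by (rule summable_on_imp_summable)
  have ev: "\<forall>\<^sub>F (n, h) in sequentially \<times>\<^sub>F sequentially. norm (t (int_decode n) h) \<le> m (int_decode n)"
    using eventually_prod2[THEN iffD2, OF _ bound, of sequentially]
    by (auto simp: case_prod_unfold elim!: eventually_mono)
  have A: "(\<lambda>h. \<Sum>n. t (int_decode n) h) \<longlonglongrightarrow> (\<Sum>n. L (int_decode n))"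
    using tannerys_theorem[OF lim ev summ sequentially_bot] by blast
  have "\<bar>L k\<bar> \<le> m k" for k
  proof (rule tendsto_upperbound[OF tendsto_rabs[OF lim]])
    show "\<forall>\<^sub>F h in sequentially. \<bar>t k h\<bar> \<le> m k" using bound by eventually_elim blast
  qed simp
  hence "(\<lambda>k. \<bar>L k\<bar>) summable_on UNIV" by (intro summable_on_comparison_test[OF m]) auto
  hence L: "(\<Sum>\<^sub>\<infinity>k. L k) = (\<Sum>n. L (int_decode n))" by (rule infsum_int_decode)
  have "\<forall>\<^sub>F h in sequentially. (\<Sum>n. t (int_decode n) h) = (\<Sum>\<^sub>\<infinity>k. t k h)"
    using bound
  proof eventually_elim
    case (elim h)
    hence "(\<lambda>k. \<bar>t k h\<bar>) summable_on UNIV" by (intro summable_on_comparison_test[OF m]) auto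
    thus ?case by (rule infsum_int_decode[symmetric])
  qed
  from Lim_transform_eventually[OF A this] show ?thesis unfolding L .
qed

text \<open>
  If consecutive quotients tend to 1, then \<open>u\<close> varies by less than any exponential rate.  This provides the
  majorant for dominated convergence: the loss \<open>\<eta> ^ \<bar>k\<bar>\<close> in replacing \<open>u (h - k)\<close> by \<open>u h\<close> is absorbed by the
  geometric decay of the weights.
\<close>

lemma subexponential_bound:
  fixes u :: "nat \<Rightarrow> real"
  assumes nz: "\<And>n. u n \<noteq> 0" and ratio: "(\<lambda>n. u (Suc n) / u n) \<longlonglongrightarrow> 1" and \<eta>: "\<eta> > 1"
  shows "\<exists>D N. \<forall>j\<ge>N. \<forall>i. \<bar>u i\<bar> \<le> D * \<eta> ^ nat \<bar>int i - int j\<bar> * \<bar>u j\<bar>"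
proof -
  have "(\<lambda>n. \<bar>u (Suc n) / u n\<bar>) \<longlonglongrightarrow> 1" using tendsto_rabs[OF ratio] by simp
  hence "\<forall>\<^sub>F n in sequentially. \<bar>u (Suc n) / u n\<bar> < \<eta> \<and> 1 / \<eta> < \<bar>u (Suc n) / u n\<bar>"
    using \<eta> by (intro eventually_conj order_tendstoD) auto
  then obtain N where N: "\<And>n. n \<ge> N \<Longrightarrow> \<bar>u (Suc n) / u n\<bar> < \<eta> \<and> 1 / \<eta> < \<bar>u (Suc n) / u n\<bar>"
    unfolding eventually_sequentially by blast
  have step: "\<bar>u (Suc n)\<bar> \<le> \<eta> * \<bar>u n\<bar>" "\<bar>u n\<bar> \<le> \<eta> * \<bar>u (Suc n)\<bar>" if "n \<ge> N" for n
    using N[OF that] nz[of n] \<eta> by (simp_all add: abs_divide field_simps)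
  have up: "\<bar>u (n + k)\<bar> \<le> \<eta> ^ k * \<bar>u n\<bar>" if "n \<ge> N" for n k
  proof (induction k)
    case (Suc k)
    have "\<bar>u (n + Suc k)\<bar> \<le> \<eta> * \<bar>u (n + k)\<bar>" using step(1)[of "n + k"] that by simp
    also have "\<dots> \<le> \<eta> * (\<eta> ^ k * \<bar>u n\<bar>)" using Suc \<eta> by (intro mult_left_mono) auto
    finally show ?case by simp
  qed simp
  have down: "\<bar>u n\<bar> \<le> \<eta> ^ k * \<bar>u (n + k)\<bar>" if "n \<ge> N" for n k
  proof (induction k)
    case (Suc k)
    have "\<bar>u n\<bar> \<le> \<eta> ^ k * \<bar>u (n + k)\<bar>" by (rule Suc)
    also have "\<dots> \<le> \<eta> ^ k * (\<eta> * \<bar>u (n + Suc k)\<bar>)"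
      using step(2)[of "n + k"] that \<eta> by (intro mult_left_mono) auto
    finally show ?case by (simp add: mult_ac)
  qed simp
  define D where "D = 1 + (\<Sum>i<N. \<bar>u i\<bar>) / \<bar>u N\<bar>"
  have D: "D \<ge> 1" unfolding D_def by (simp add: sum_nonneg)
  have "\<bar>u i\<bar> \<le> D * \<eta> ^ nat \<bar>int i - int j\<bar> * \<bar>u j\<bar>" if j: "j \<ge> N" for i j
  proof (cases "i \<ge> N")
    case True
    have "\<bar>u i\<bar> \<le> \<eta> ^ nat \<bar>int i - int j\<bar> * \<bar>u j\<bar>"
    proof (cases "i \<le> j")
      case le: True
      have "nat \<bar>int i - int j\<bar> = j - i" using le by simp
      thus ?thesis using down[OF True, of "j - i"] le by simp
    next
      case False
      have "nat \<bar>int i - int j\<bar> = i - j" using False by simp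
      thus ?thesis using up[OF j, of "i - j"] False by simp
    qed
    also have "\<dots> \<le> D * (\<eta> ^ nat \<bar>int i - int j\<bar> * \<bar>u j\<bar>)"
      using mult_right_mono[OF D, of "\<eta> ^ nat \<bar>int i - int j\<bar> * \<bar>u j\<bar>"] \<eta> by simp
    finally show ?thesis by (simp add: mult.assoc)
  next
    case False
    have "\<bar>u i\<bar> \<le> (\<Sum>i<N. \<bar>u i\<bar>)" using False by (intro member_le_sum) auto
    also have "\<dots> \<le> D * \<bar>u N\<bar>" using nz[of N] by (simp add: D_def distrib_right)
    also have "\<dots> \<le> D * (\<eta> ^ (j - N) * \<bar>u j\<bar>)"
      using down[of N "j - N"] j D by (intro mult_left_mono) auto
    also have "\<dots> \<le> D * (\<eta> ^ nat \<bar>int i - int j\<bar> * \<bar>u j\<bar>)"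
      using \<eta> D False j by (intro mult_left_mono mult_right_mono power_increasing) auto
    finally show ?thesis by (simp add: mult.assoc)
  qed
  thus ?thesis by blast
qed

lemma ratio_shift:
  fixes u :: "nat \<Rightarrow> real"
  assumes nz: "\<And>n. u n \<noteq> 0" and ratio: "(\<lambda>n. u (Suc n) / u n) \<longlonglongrightarrow> 1"
  shows "(\<lambda>n. u (n + m) / u n) \<longlonglongrightarrow> 1"
proof (induction m)
  case (Suc m)
  have "(\<lambda>n. u (Suc (n + m)) / u (n + m)) \<longlonglongrightarrow> 1"
    by (rule LIMSEQ_ignore_initial_segment[OF ratio])
  from tendsto_mult[OF this Suc] show ?case using nz by simp
qed (use nz in simp)

text \<open>
  Since \<open>q\<close> lives on the multiples of \<open>s\<close>, a convolution with \<open>q\<close> evaluated at \<open>s h + r\<close> only involves the weights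
  with index congruent to \<open>r\<close>.
\<close>

lemma has_sum_residue_class:
  fixes a q :: "int \<Rightarrow> real"
  assumes s: "s \<ge> 1" and q: "\<And>j. \<not> int s dvd j \<Longrightarrow> q j = 0"
  shows "((\<lambda>m. a m * q (int s * h + r - m)) has_sum x) UNIV \<longleftrightarrow>
         ((\<lambda>k. a (int s * k + r) * q (int s * h - int s * k)) has_sum x) UNIV"
proof -
  have "((\<lambda>m. a m * q (int s * h + r - m)) has_sum x) UNIV \<longleftrightarrow>
        ((\<lambda>m. a m * q (int s * h + r - m)) has_sum x) (range (\<lambda>k. int s * k + r))"
  proof (rule has_sum_cong_neutral)
    fix m assume m: "m \<in> UNIV - range (\<lambda>k. int s * k + r)"
    have "\<not> int s dvd (int s * h + r - m)"
    proof
      assume "int s dvd (int s * h + r - m)"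
      then obtain k where "int s * h + r - m = int s * k" by blast
      hence "m = int s * (h - k) + r" by (simp add: algebra_simps)
      thus False using m by blast
    qed
    thus "a m * q (int s * h + r - m) = 0" using q by simp
  qed auto
  also have "\<dots> \<longleftrightarrow> ((\<lambda>k. a (int s * k + r) * q (int s * h - int s * k)) has_sum x) UNIV"
    using s by (subst has_sum_reindex) (auto simp: inj_on_def o_def)
  finally show ?thesis .
qed

lemma sum_residue_classes:
  fixes a :: "int \<Rightarrow> real"
  assumes s: "s \<ge> 1" and a: "(\<lambda>k. \<bar>a k\<bar>) summable_on UNIV"
  shows "(\<Sum>r<s. \<Sum>\<^sub>\<infinity>k. a (int s * k + int r)) = (\<Sum>\<^sub>\<infinity>k. a k)"
proof -
  have "(a has_sum (\<Sum>\<^sub>\<infinity>k. a k)) UNIV" by (rule has_sum_infsum[OF summable_on_if_abs[OF a]])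
  also have "?this \<longleftrightarrow> ((\<lambda>(r, k). a (int s * k + int r)) has_sum (\<Sum>\<^sub>\<infinity>k. a k)) ({..<s} \<times> UNIV)"
    by (rule has_sum_reindex_bij_witness[of _ "\<lambda>(r, k). int s * k + int r"
          "\<lambda>m. (nat (m mod int s), m div int s)"])
       (use s in \<open>auto simp: nat_less_iff nat_mod_distrib\<close>)
  finally have "((\<lambda>r. \<Sum>\<^sub>\<infinity>k. a (int s * k + int r)) has_sum (\<Sum>\<^sub>\<infinity>k. a k)) {..<s}"
  proof (rule has_sum_SigmaD)
    fix r
    have "a summable_on range (\<lambda>k. int s * k + int r)"
      by (rule summable_on_subset_banach[OF summable_on_if_abs[OF a]]) simp
    hence "(\<lambda>k. a (int s * k + int r)) summable_on UNIV"
      using s by (subst (asm) summable_on_reindex) (auto simp: inj_on_def o_def)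
    thus "((\<lambda>k. case (r, k) of (r, k) \<Rightarrow> a (int s * k + int r)) has_sum (\<Sum>\<^sub>\<infinity>k. a (int s * k + int r))) UNIV"
      by simp
  qed
  thus ?thesis by (rule has_sum_unique[OF has_sum_finite[OF finite_lessThan]])
qed

text \<open>
  For \<open>0 \<le> r < s\<close> one has \<open>\<bar>s k + r\<bar> \<ge> \<bar>k\<bar>\<close> for every integer \<open>k\<close>, so the same bound holds on each residue class.
\<close>

lemma geometric_residue_class:
  fixes a :: "int \<Rightarrow> real"
  assumes s: "s \<ge> 1" and "r < s" and \<rho>: "0 < \<rho>" "\<rho> < 1" and a: "\<And>k. \<bar>a k\<bar> \<le> C * \<rho> ^ nat \<bar>k\<bar>"
  shows "\<bar>a (int s * k + int r)\<bar> \<le> C * \<rho> ^ nat \<bar>k\<bar>"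
proof -
  have C: "C \<ge> 0" using a[of 0] by simp
  have "\<bar>k\<bar> \<le> \<bar>int s * k + int r\<bar>"
  proof (cases "k \<ge> 0")
    case True
    have "1 * k \<le> int s * k" using s True by (intro mult_right_mono) auto
    thus ?thesis using True by simp
  next
    case False
    have "(int s - 1) * (k + 1) \<le> 0" using s False by (intro mult_nonneg_nonpos) auto
    hence "int s * k + int s \<le> k + 1" by (simp add: algebra_simps)
    hence "int s * k + int r \<le> k" using \<open>r < s\<close> by linarith
    thus ?thesis using False by simp
  qed
  hence "\<rho> ^ nat \<bar>int s * k + int r\<bar> \<le> \<rho> ^ nat \<bar>k\<bar>" using \<rho> by (intro power_decreasing) auto
  thus ?thesis using a[of "int s * k + int r"] C by (meson mult_left_mono order_trans)
qed

text \<open>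
  Dominated convergence for the quotients \<open>q (s (h - k)) / u h\<close>, each of which tends to 1 as \<open>h \<longlonglongrightarrow> \<infinity>\<close>.  The
  hypotheses on \<open>q\<close> cover both an even sequence and one that vanishes at negative indices.
\<close>

lemma smoothing_residue_limit:
  fixes a q :: "int \<Rightarrow> real" and x u :: "nat \<Rightarrow> real"
  assumes s: "s \<ge> 1" and r: "r < s"
    and \<rho>: "0 < \<rho>" "\<rho> < 1" and a: "\<And>k. \<bar>a k\<bar> \<le> C * \<rho> ^ nat \<bar>k\<bar>"
    and q0: "\<And>j. \<not> int s dvd j \<Longrightarrow> q j = 0"
    and qu: "\<And>n. q (int s * int n) = u n"
    and qb: "\<And>i. \<bar>q (int s * i)\<bar> \<le> \<bar>u (nat \<bar>i\<bar>)\<bar>"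
    and x: "\<And>n. ((\<lambda>m. a m * q (int n - m)) has_sum x n) UNIV"
    and nz: "\<And>n. u n \<noteq> 0" and ratio: "(\<lambda>n. u (Suc n) / u n) \<longlonglongrightarrow> 1"
  shows "(\<lambda>h. x (s * h + r) / u h) \<longlonglongrightarrow> (\<Sum>\<^sub>\<infinity>k. a (int s * k + int r))"
proof -
  \<comment> \<open>any number strictly between 1 and \<open>1 / \<rho>\<close>\<close>
  define \<eta> where "\<eta> = (1 + 1 / \<rho>) / 2"
  have \<eta>: "\<eta> > 1" "\<rho> * \<eta> < 1" using \<rho> by (simp_all add: \<eta>_def field_simps)
  obtain D N where D: "\<And>i j. j \<ge> N \<Longrightarrow> \<bar>u i\<bar> \<le> D * \<eta> ^ nat \<bar>int i - int j\<bar> * \<bar>u j\<bar>"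
    using subexponential_bound[OF nz ratio \<eta>(1)] by blast
  have C: "C \<ge> 0" using a[of 0] by simp
  have D0: "D \<ge> 0" using D[of N N] nz[of N] by (simp add: mult_le_cancel_right1)
  define t where "t k h = a (int s * k + int r) * (q (int s * int h - int s * k) / u h)" for k h
  have sum: "(\<Sum>\<^sub>\<infinity>k. t k h) = x (s * h + r) / u h" for h
  proof -
    have "((\<lambda>k. a (int s * k + int r) * q (int s * int h - int s * k)) has_sum x (s * h + r)) UNIV"
      using x[of "s * h + r"] has_sum_residue_class[where q = q, OF s q0, of a "int h" "int r"] by simp
    from has_sum_cmult_left[OF this, of "inverse (u h)"] show ?thesis
      unfolding t_def by (intro infsumI) (simp add: divide_inverse mult.assoc)
  qed
  have "(\<lambda>h. \<Sum>\<^sub>\<infinity>k. t k h) \<longlonglongrightarrow> (\<Sum>\<^sub>\<infinity>k. a (int s * k + int r))"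
  proof (rule tannery_int)
    fix k :: int
    have "(\<lambda>h. q (int s * int h - int s * k) / u h) \<longlonglongrightarrow> 1"
    proof (cases "k \<ge> 0")
      case True
      then obtain m where k: "k = int m" by (metis nonneg_int_cases)
      have "(\<lambda>h. q (int s * int (h + m) - int s * k) / u (h + m)) \<longlonglongrightarrow> 1"
        using tendsto_inverse[OF ratio_shift[OF nz ratio, of m]] qu by (simp add: k algebra_simps)
      thus ?thesis by (rule LIMSEQ_offset)
    next
      case False
      then obtain m where k: "k = - int m" by (metis nonpos_int_cases linear)
      have "int s * int h - int s * k = int s * int (h + m)" for h by (simp add: k algebra_simps)
      thus ?thesis using ratio_shift[OF nz ratio, of m] by (simp only: qu)
    qed
    from tendsto_mult[OF tendsto_const this, of "a (int s * k + int r)"]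
    show "t k \<longlonglongrightarrow> a (int s * k + int r)" by (simp add: t_def[abs_def])
  next
    show "\<forall>\<^sub>F h in sequentially. \<forall>k. \<bar>t k h\<bar> \<le> C * D * (\<rho> * \<eta>) ^ nat \<bar>k\<bar>"
      using eventually_ge_at_top[of N]
    proof eventually_elim
      case (elim h)
      show ?case
      proof
        fix k
        have "\<bar>q (int s * int h - int s * k)\<bar> \<le> \<bar>u (nat \<bar>int h - k\<bar>)\<bar>"
          using qb[of "int h - k"] by (simp add: right_diff_distrib)
        also have "\<dots> \<le> D * \<eta> ^ nat \<bar>int (nat \<bar>int h - k\<bar>) - int h\<bar> * \<bar>u h\<bar>"
          by (rule D[OF elim])
        also have "\<dots> \<le> D * \<eta> ^ nat \<bar>k\<bar> * \<bar>u h\<bar>"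
          using \<eta> D0 by (intro mult_right_mono mult_left_mono power_increasing) auto
        finally have "\<bar>q (int s * int h - int s * k) / u h\<bar> \<le> D * \<eta> ^ nat \<bar>k\<bar>"
          using nz[of h] by (simp add: abs_divide divide_le_eq)
        hence "\<bar>t k h\<bar> \<le> (C * \<rho> ^ nat \<bar>k\<bar>) * (D * \<eta> ^ nat \<bar>k\<bar>)"
          unfolding t_def abs_mult
          using geometric_residue_class[OF s r \<rho> a, of k] C \<rho> by (intro mult_mono) auto
        thus "\<bar>t k h\<bar> \<le> C * D * (\<rho> * \<eta>) ^ nat \<bar>k\<bar>" by (simp add: power_mult_distrib mult_ac)
      qed
    qed
    show "(\<lambda>k. C * D * (\<rho> * \<eta>) ^ nat \<bar>k\<bar>) summable_on UNIV"
      using \<eta> \<rho> by (intro summable_on_cmult_right geometric_summable_on_int) auto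
  qed
  thus ?thesis by (simp only: sum)
qed

text \<open>
  A convolution with a finitely supported \<open>q\<close> is a finite combination of shifts of \<open>a\<close>.
\<close>

lemma smoothing_finite_support:
  fixes a q :: "int \<Rightarrow> real" and x :: "nat \<Rightarrow> real"
  assumes \<rho>: "0 < \<rho>" "\<rho> < 1" and a: "\<And>k. \<bar>a k\<bar> \<le> C * \<rho> ^ nat \<bar>k\<bar>"
    and q0: "\<And>j. \<bar>j\<bar> > int J \<Longrightarrow> q j = 0"
    and x: "\<And>n. ((\<lambda>m. a m * q (int n - m)) has_sum x n) UNIV"
  shows "\<exists>B. \<forall>n. \<bar>x n\<bar> \<le> B * \<rho> ^ n"
proof -
  have C: "C \<ge> 0" using a[of 0] by simp
  define I where "I = {- int J..int J}"
  have xn: "x n = (\<Sum>j\<in>I. a (int n - j) * q j)" for n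
  proof -
    have "((\<lambda>j. a (int n - j) * q j) has_sum x n) UNIV"
      using x[of n] has_sum_reindex_bij_witness[of UNIV "\<lambda>j. int n - j" "\<lambda>j. int n - j" UNIV
          "\<lambda>j. a (int n - j) * q j" "\<lambda>m. a m * q (int n - m)" "x n" "x n"] by simp
    also have "?this \<longleftrightarrow> ((\<lambda>j. a (int n - j) * q j) has_sum x n) I"
      by (rule has_sum_cong_neutral) (auto simp: I_def intro!: q0)
    finally have "((\<lambda>j. a (int n - j) * q j) has_sum x n) I" .
    moreover have "finite I" by (simp add: I_def)
    ultimately show ?thesis by (rule has_sum_unique[OF _ has_sum_finite])
  qed
  have "\<bar>x n\<bar> \<le> (C / \<rho> ^ J * (\<Sum>j\<in>I. \<bar>q j\<bar>)) * \<rho> ^ n" for n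
  proof -
    have "\<bar>a (int n - j)\<bar> \<le> C / \<rho> ^ J * \<rho> ^ n" if "j \<in> I" for j
    proof -
      have "\<rho> ^ (nat \<bar>int n - j\<bar> + J) \<le> \<rho> ^ n"
        using that \<rho> by (intro power_decreasing) (auto simp: I_def)
      hence "\<rho> ^ nat \<bar>int n - j\<bar> \<le> \<rho> ^ n / \<rho> ^ J" using \<rho> by (simp add: power_add pos_le_divide_eq)
      from mult_left_mono[OF this C] show ?thesis using a[of "int n - j"] by simp
    qed
    hence "\<bar>a (int n - j) * q j\<bar> \<le> (C / \<rho> ^ J * \<rho> ^ n) * \<bar>q j\<bar>" if "j \<in> I" for j
      unfolding abs_mult using that by (intro mult_right_mono) simp_all
    hence "\<bar>x n\<bar> \<le> (\<Sum>j\<in>I. (C / \<rho> ^ J * \<rho> ^ n) * \<bar>q j\<bar>)"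
      unfolding xn by (intro order_trans[OF sum_abs] sum_mono)
    thus ?thesis by (simp add: sum_distrib_left mult_ac)
  qed
  thus ?thesis by blast
qed

text \<open>
  If \<open>u\<close> never vanishes, \<open>G\<close> is the quotient of \<open>x\<close> by \<open>u\<close> and there is no error at all.  If \<open>u\<close> vanishes
  eventually, \<open>q\<close> is finitely supported, \<open>x\<close> is itself within the error term, and the values of
  \<open>G\<close> only have to sum to the right limit over a period; the total weight divided by \<open>s\<close> does this.
\<close>

lemma smoothing:
  fixes a q :: "int \<Rightarrow> real" and x u :: "nat \<Rightarrow> real"
  assumes s: "s \<ge> 1"
    and \<rho>: "0 < \<rho>" "\<rho> < 1" and a: "\<And>k. \<bar>a k\<bar> \<le> C * \<rho> ^ nat \<bar>k\<bar>"
    and q0: "\<And>j. \<not> int s dvd j \<Longrightarrow> q j = 0"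
    and qu: "\<And>n. q (int s * int n) = u n"
    and qb: "\<And>i. \<bar>q (int s * i)\<bar> \<le> \<bar>u (nat \<bar>i\<bar>)\<bar>"
    and x: "\<And>n. ((\<lambda>m. a m * q (int n - m)) has_sum x n) UNIV"
    and u: "(\<forall>n. u n \<noteq> 0) \<and> (\<lambda>n. u (Suc n) / u n) \<longlonglongrightarrow> 1 \<or> (\<exists>N. \<forall>n\<ge>N. u n = 0)"
  shows "\<exists>G :: int \<Rightarrow> real. (\<lambda>h. \<Sum>r<s. G (int (s * h + r))) \<longlonglongrightarrow> (\<Sum>\<^sub>\<infinity>k. a k) \<and>
     (\<exists>B. \<forall>\<^sub>F n in sequentially. \<bar>x n - u (n div s) * G (int n)\<bar> \<le> B * \<rho> ^ n)"
  using u
proof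
  assume u: "(\<forall>n. u n \<noteq> 0) \<and> (\<lambda>n. u (Suc n) / u n) \<longlonglongrightarrow> 1"
  define G where "G n = x (nat n) / u (nat n div s)" for n
  have abs: "(\<lambda>k. \<bar>a k\<bar>) summable_on UNIV"
    by (rule summable_on_comparison_test[where f = "\<lambda>k. C * \<rho> ^ nat \<bar>k\<bar>"])
       (use a in \<open>auto intro!: summable_on_cmult_right geometric_summable_on_int \<rho>\<close>)
  have "(\<lambda>h. \<Sum>r<s. x (s * h + r) / u h) \<longlonglongrightarrow> (\<Sum>r<s. \<Sum>\<^sub>\<infinity>k. a (int s * k + int r))"
  proof (rule tendsto_sum)
    fix r assume "r \<in> {..<s}"
    thus "(\<lambda>h. x (s * h + r) / u h) \<longlonglongrightarrow> (\<Sum>\<^sub>\<infinity>k. a (int s * k + int r))"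
      using u by (intro smoothing_residue_limit[OF s _ \<rho> a q0 qu qb x]) auto
  qed
  moreover have "G (int (s * h + r)) = x (s * h + r) / u h" if "r < s" for h r
    using that unfolding G_def nat_int by simp
  hence "(\<Sum>r<s. G (int (s * h + r))) = (\<Sum>r<s. x (s * h + r) / u h)" for h
    by (intro sum.cong) auto
  ultimately have "(\<lambda>h. \<Sum>r<s. G (int (s * h + r))) \<longlonglongrightarrow> (\<Sum>\<^sub>\<infinity>k. a k)"
    by (simp only: sum_residue_classes[OF s abs])
  moreover have "\<bar>x n - u (n div s) * G (int n)\<bar> \<le> 0 * \<rho> ^ n" for n using u by (simp add: G_def)
  ultimately show ?thesis by (blast intro: always_eventually)
next
  assume "\<exists>N. \<forall>n\<ge>N. u n = 0"
  then obtain N where N: "\<And>n. n \<ge> N \<Longrightarrow> u n = 0" by blast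
  define G :: "int \<Rightarrow> real" where "G n = (\<Sum>\<^sub>\<infinity>k. a k) / real s" for n
  have "q j = 0" if j: "\<bar>j\<bar> > int (s * N)" for j
  proof (cases "int s dvd j")
    case True
    then obtain i where i: "j = int s * i" by blast
    have "int s * \<bar>i\<bar> > int s * int N" using j by (simp add: i abs_mult)
    hence "\<bar>i\<bar> > int N" using s by simp
    hence "u (nat \<bar>i\<bar>) = 0" by (intro N) simp
    thus ?thesis using qb[of i] by (simp add: i)
  qed (rule q0)
  from smoothing_finite_support[OF \<rho> a this x] obtain B where B: "\<And>n. \<bar>x n\<bar> \<le> B * \<rho> ^ n" by blast
  have "(\<lambda>h. \<Sum>r<s. G (int (s * h + r))) \<longlonglongrightarrow> (\<Sum>\<^sub>\<infinity>k. a k)"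
    using s by (simp add: G_def)
  moreover have "\<forall>\<^sub>F n in sequentially. \<bar>x n - u (n div s) * G (int n)\<bar> \<le> B * \<rho> ^ n"
    using eventually_ge_at_top[of "s * N"]
  proof eventually_elim
    case (elim n)
    hence "N \<le> n div s" using s by (simp add: less_eq_div_iff_mult_less_eq mult.commute)
    thus ?case using N B by simp
  qed
  ultimately show ?thesis by blast
qed

lemma geometric_smallo:
  fixes \<rho> :: real
  assumes "0 < \<rho>" "\<rho> < 1"
  shows "(\<lambda>h::nat. \<rho> ^ h) \<in> o(\<lambda>h. real h powr (- \<nu>))"
  using assms by real_asymp

text \<open>
  The shift \<open>m\<close> serves the coefficient at the lag \<open>s h + r - 1\<close>, which for \<open>r = 0\<close> belongs to the period before \<open>h\<close>.
\<close>

lemma geometric_bound_smallo: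
  fixes \<epsilon> :: "nat \<Rightarrow> real"
  assumes \<rho>: "0 < \<rho>" "\<rho> < 1" and s: "s \<ge> 1"
    and \<epsilon>: "\<forall>\<^sub>F n in sequentially. \<bar>\<epsilon> n\<bar> \<le> B * \<rho> ^ n"
    and g: "\<forall>\<^sub>F h in sequentially. f h = c * \<epsilon> (s * h + r - m)"
  shows "f \<in> o(\<lambda>h. real h powr (- \<nu>))"
proof (rule landau_o.big_small_trans[OF _ geometric_smallo[OF \<rho>]])
  have fil: "filterlim (\<lambda>h. s * h + r - m) at_top sequentially"
  proof (rule filterlim_at_top_mono)
    show "filterlim (\<lambda>h. h - m) at_top sequentially"
      by (rule filterlim_minus_const_nat_at_top)
    show "\<forall>\<^sub>F h in sequentially. h - m \<le> s * h + r - m"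
    proof (intro always_eventually allI diff_le_mono)
      fix h show "h \<le> s * h + r" using mult_le_mono1[OF s, of h] by linarith
    qed
  qed
  have "\<forall>\<^sub>F h in sequentially. \<bar>f h\<bar> \<le> \<bar>c\<bar> * \<bar>B\<bar> / \<rho> ^ m * \<rho> ^ h"
    using eventually_compose_filterlim[OF \<epsilon> fil] g eventually_ge_at_top[of m]
  proof eventually_elim
    case (elim h)
    have "h \<le> (s * h + r - m) + m" using mult_le_mono1[OF s, of h] elim by linarith
    hence "\<rho> ^ ((s * h + r - m) + m) \<le> \<rho> ^ h" using \<rho> by (intro power_decreasing) auto
    hence p: "\<rho> ^ (s * h + r - m) \<le> \<rho> ^ h / \<rho> ^ m" using \<rho> by (simp add: power_add pos_le_divide_eq)
    have "\<bar>f h\<bar> \<le> \<bar>c\<bar> * (B * \<rho> ^ (s * h + r - m))"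
      using elim by (simp add: abs_mult mult_left_mono)
    also have "\<dots> \<le> \<bar>c\<bar> * (\<bar>B\<bar> * (\<rho> ^ h / \<rho> ^ m))"
      using p \<rho> by (intro mult_left_mono mult_mono) auto
    finally show ?case by simp
  qed
  thus "f \<in> O(\<lambda>h. \<rho> ^ h)"
    using \<rho> by (intro bigoI[where c = "\<bar>c\<bar> * \<bar>B\<bar> / \<rho> ^ m"]) simp
qed

section \<open>Asymptotics of the autocovariances and coefficients\<close>

text \<open>
  The coefficients vanish eventually exactly when \<open>d\<close> is a nonpositive integer, that is, when \<open>(1 - z) powr (- d)\<close>
  is a polynomial.
\<close>

lemma fracdiff_dichotomy:
  "(\<forall>n. fracdiff d n \<noteq> 0) \<and> (\<lambda>n. fracdiff d (Suc n) / fracdiff d n) \<longlonglongrightarrow> 1 \<or>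
   (\<exists>N. \<forall>n\<ge>N. fracdiff d n = 0)"
proof (cases "\<exists>m. d = - real m")
  case True
  then obtain m where "d = - real m" by blast
  hence "fracdiff d n = 0" if "n \<ge> Suc m" for n
    using that by (auto simp: fracdiff_def pochhammer_eq_0_iff)
  thus ?thesis by blast
next
  case False
  hence nz: "fracdiff d n \<noteq> 0" for n by (auto simp: fracdiff_def pochhammer_eq_0_iff)
  have "fracdiff d (Suc n) / fracdiff d n = (d + real n) / (real n + 1)" for n
  proof -
    have "fracdiff d (Suc n) = fracdiff d n * ((d + real n) / (real n + 1))"
      by (simp add: fracdiff_def pochhammer_Suc add.commute)
    thus ?thesis using nz[of n] by simp
  qed
  moreover have "(\<lambda>n. (d + real n) / (real n + 1)) \<longlonglongrightarrow> 1" by real_asymp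
  ultimately show ?thesis using nz by simp
qed

text \<open>
  By \<open>rGamma_diff_nat\<close> the signs cancel and \<open>u n\<close> is a constant times
  \<open>pochhammer d n / \<Gamma>(1 - d + n)\<close>; for \<open>v \<noteq> 0\<close> it vanishes eventually exactly when \<open>d\<close> is a nonpositive integer.
\<close>

lemma gamma_V_dichotomy:
  fixes v d :: real
  assumes s: "s \<ge> 1" and d: "d < 1/2"
  defines "u \<equiv> \<lambda>n::nat. gamma_V s d v (int s * int n)"
  shows "(\<forall>n. u n \<noteq> 0) \<and> (\<lambda>n. u (Suc n) / u n) \<longlonglongrightarrow> 1 \<or> (\<exists>N. \<forall>n\<ge>N. u n = 0)"
proof -
  define c where "c = v * Gamma (1 - 2 * d) * rGamma (1 - d)"
  have u: "u n = c * (pochhammer d n * rGamma (1 - d + real n))" for n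
  proof -
    have "(-1) ^ n * (-1) ^ n = (1 :: real)" by (simp flip: power_mult_distrib)
    thus ?thesis using s by (simp add: u_def gamma_V_def c_def rGamma_diff_nat mult_ac)
  qed
  have rG: "rGamma x \<noteq> 0" if "x > 0" for x :: real
    using Gamma_real_pos[OF that] by (simp add: rGamma_inverse_Gamma)
  show ?thesis
  proof (cases "v = 0 \<or> (\<exists>m. d = - real m)")
    case True
    then obtain m where "v = 0 \<or> d = - real m" by blast
    hence "u n = 0" if "n \<ge> Suc m" for n
      using that unfolding u c_def by (auto simp: pochhammer_eq_0_iff)
    thus ?thesis by blast
  next
    case False
    have "Gamma (1 - 2 * d) > 0" using d by (intro Gamma_real_pos) simp
    hence "Gamma (1 - 2 * d) \<noteq> 0" by (rule less_imp_neq[symmetric])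
    hence "c \<noteq> 0" using False rG[of "1 - d"] d unfolding c_def by simp
    moreover have p: "pochhammer d n \<noteq> 0" for n using False by (auto simp: pochhammer_eq_0_iff)
    ultimately have nz: "u n \<noteq> 0" for n using rG[of "1 - d + real n"] d by (simp add: u)
    have "u (Suc n) / u n = (d + real n) / (1 - d + real n)" for n
    proof -
      have "rGamma (1 - d + real n) = (1 - d + real n) * rGamma (1 - d + real (Suc n))"
        using rGamma_plus1[of "1 - d + real n"] by (simp add: add_ac)
      thus ?thesis using \<open>c \<noteq> 0\<close> p[of n] rG[of "1 - d + real (Suc n)"] d
        by (simp only: u pochhammer_Suc) (simp add: divide_simps)
    qed
    moreover have "(\<lambda>n. (d + real n) / (1 - d + real n)) \<longlonglongrightarrow> 1" by real_asymp
    ultimately show ?thesis using nz by simp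
  qed
qed

lemma extend0_geometric:
  assumes "\<And>k. \<bar>a k\<bar> \<le> C * \<rho> ^ k" and "0 < \<rho>"
  shows "\<bar>extend0 a i\<bar> \<le> C * \<rho> ^ nat \<bar>i\<bar>"
proof -
  have "C \<ge> 0" using assms(1)[of 0] by simp
  thus ?thesis using assms by (simp add: extend0_def)
qed

lemma gamma_A_geometric:
  assumes f: "\<And>k. \<bar>arma_coeff \<alpha> \<beta> k\<bar> \<le> C * \<rho> ^ k" and \<rho>: "0 < \<rho>" "\<rho> < 1"
  shows "\<exists>B. \<forall>m. \<bar>gamma_A \<alpha> \<beta> m\<bar> \<le> B * \<rho> ^ nat \<bar>m\<bar>"
proof -
  let ?f = "arma_coeff \<alpha> \<beta>"
  have C: "C \<ge> 0" using f[of 0] by simp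
  have geo: "summable (\<lambda>i. \<rho> ^ i)" using \<rho> by (simp add: summable_geometric)
  have "\<bar>gamma_A \<alpha> \<beta> m\<bar> \<le> (C * C * (\<Sum>i. \<rho> ^ i)) * \<rho> ^ nat \<bar>m\<bar>" for m
  proof -
    let ?n = "nat \<bar>m\<bar>"
    have bound: "norm (?f i * ?f (i + ?n)) \<le> C * C * \<rho> ^ ?n * \<rho> ^ i" for i
    proof -
      have "\<bar>?f (i + ?n)\<bar> \<le> C * \<rho> ^ ?n"
      proof -
        have "\<rho> ^ (i + ?n) \<le> \<rho> ^ ?n" using \<rho> by (intro power_decreasing) auto
        thus ?thesis using f[of "i + ?n"] C by (meson mult_left_mono order_trans)
      qed
      hence "\<bar>?f i\<bar> * \<bar>?f (i + ?n)\<bar> \<le> (C * \<rho> ^ i) * (C * \<rho> ^ ?n)"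
        using f[of i] C \<rho> by (intro mult_mono) auto
      thus ?thesis by (simp add: abs_mult mult_ac)
    qed
    have "\<bar>gamma_A \<alpha> \<beta> m\<bar> \<le> (\<Sum>i. C * C * \<rho> ^ ?n * \<rho> ^ i)"
      unfolding gamma_A_def real_norm_def[symmetric]
      by (rule norm_suminf_le[OF bound summable_mult[OF geo]])
    also have "\<dots> = C * C * \<rho> ^ ?n * (\<Sum>i. \<rho> ^ i)" by (rule suminf_mult[OF geo])
    finally show ?thesis by (simp add: mult_ac)
  qed
  thus ?thesis by blast
qed

context sfiegarch_l2
begin

lemma autocov_\<sigma>_smoothing:
  assumes d: "d < 1/2"
  shows "gamma_A \<alpha> \<beta> summable_on UNIV"
    and "\<exists>G :: int \<Rightarrow> real.
      (\<lambda>h. \<Sum>r<s. G (int (s * h + r))) \<longlonglongrightarrow> (\<Sum>\<^sub>\<infinity>k. gamma_A \<alpha> \<beta> k) \<and>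
      (\<exists>B \<rho>. 0 < \<rho> \<and> \<rho> < 1 \<and> (\<forall>\<^sub>F n in sequentially.
        \<bar>autocov M (log_sq \<sigma>) (int n) - gamma_V s d vg (int s * int (n div s)) * G (int n)\<bar> \<le> B * \<rho> ^ n))"
proof -
  obtain C \<rho> where \<rho>: "0 < \<rho>" "\<rho> < 1" and f: "\<And>k. \<bar>arma_coeff \<alpha> \<beta> k\<bar> \<le> C * \<rho> ^ k"
    using arma_coeff_geometric(1)[OF \<beta>_nz] by blast
  obtain B where A: "\<And>m. \<bar>gamma_A \<alpha> \<beta> m\<bar> \<le> B * \<rho> ^ nat \<bar>m\<bar>"
    using gamma_A_geometric[OF f \<rho>] by blast
  show "gamma_A \<alpha> \<beta> summable_on UNIV"
  proof (rule summable_on_if_abs, rule summable_on_comparison_test)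
    show "(\<lambda>m. B * \<rho> ^ nat \<bar>m\<bar>) summable_on UNIV"
      by (rule summable_on_cmult_right[OF geometric_summable_on_int[OF \<rho>]])
  qed (use A in auto)
  have "\<exists>G :: int \<Rightarrow> real.
      (\<lambda>h. \<Sum>r<s. G (int (s * h + r))) \<longlonglongrightarrow> (\<Sum>\<^sub>\<infinity>k. gamma_A \<alpha> \<beta> k) \<and>
      (\<exists>B. \<forall>\<^sub>F n in sequentially.
        \<bar>autocov M (log_sq \<sigma>) (int n) - gamma_V s d vg (int s * int (n div s)) * G (int n)\<bar> \<le> B * \<rho> ^ n)"
  proof (rule smoothing[OF s_ge_1 \<rho> A, where q = "gamma_V s d vg"])
    show "gamma_V s d vg j = 0" if "\<not> int s dvd j" for j
      using that by (simp add: gamma_V_def)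
    show "\<bar>gamma_V s d vg (int s * i)\<bar> \<le> \<bar>gamma_V s d vg (int s * int (nat \<bar>i\<bar>))\<bar>" for i
    proof (cases "i \<ge> 0")
      case False
      hence "int s * int (nat \<bar>i\<bar>) = - (int s * i)" by simp
      thus ?thesis by (simp only: gamma_V_uminus)
    qed simp
    show "((\<lambda>m. gamma_A \<alpha> \<beta> m * gamma_V s d vg (int n - m)) has_sum autocov M (log_sq \<sigma>) (int n)) UNIV" for n
      by (rule autocov_log_sq_\<sigma>_has_sum[OF d])
    show "(\<forall>n. gamma_V s d vg (int s * int n) \<noteq> 0) \<and>
        (\<lambda>n. gamma_V s d vg (int s * int (Suc n)) / gamma_V s d vg (int s * int n)) \<longlonglongrightarrow> 1 \<or>
        (\<exists>N. \<forall>n\<ge>N. gamma_V s d vg (int s * int n) = 0)"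
      by (rule gamma_V_dichotomy[OF s_ge_1 d])
  qed simp_all
  thus "\<exists>G :: int \<Rightarrow> real.
      (\<lambda>h. \<Sum>r<s. G (int (s * h + r))) \<longlonglongrightarrow> (\<Sum>\<^sub>\<infinity>k. gamma_A \<alpha> \<beta> k) \<and>
      (\<exists>B \<rho>. 0 < \<rho> \<and> \<rho> < 1 \<and> (\<forall>\<^sub>F n in sequentially.
        \<bar>autocov M (log_sq \<sigma>) (int n) - gamma_V s d vg (int s * int (n div s)) * G (int n)\<bar> \<le> B * \<rho> ^ n))"
    using \<rho> by blast
qed

lemma coeff_smoothing:
  "\<exists>K :: int \<Rightarrow> real.
      (\<lambda>h. \<Sum>r<s. K (int (s * h + r))) \<longlonglongrightarrow> poly \<alpha> 1 / poly \<beta> 1 \<and>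
      (\<exists>B \<rho>. 0 < \<rho> \<and> \<rho> < 1 \<and> (\<forall>\<^sub>F n in sequentially.
        \<bar>lam n - fracdiff d (n div s) * K (int n)\<bar> \<le> B * \<rho> ^ n))"
proof -
  obtain C \<rho> where \<rho>: "0 < \<rho>" "\<rho> < 1" and f: "\<And>k. \<bar>arma_coeff \<alpha> \<beta> k\<bar> \<le> C * \<rho> ^ k"
    using arma_coeff_geometric(1)[OF \<beta>_nz] by blast
  have total: "(\<Sum>\<^sub>\<infinity>k. extend0 (arma_coeff \<alpha> \<beta>) k) = poly \<alpha> 1 / poly \<beta> 1"
    by (rule infsumI[OF extend0_has_sum[OF arma_abs_summable arma_coeff_geometric(2)[OF \<beta>_nz]]])
  have mult: "extend0 (frac_coeff s d) (int s * int n) = fracdiff d n" for n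
    using frac_coeff_multiple[OF s_ge_1, of d n]
    by (simp add: extend0_def flip: of_nat_mult)
  have "\<exists>K :: int \<Rightarrow> real.
      (\<lambda>h. \<Sum>r<s. K (int (s * h + r))) \<longlonglongrightarrow> (\<Sum>\<^sub>\<infinity>k. extend0 (arma_coeff \<alpha> \<beta>) k) \<and>
      (\<exists>B. \<forall>\<^sub>F n in sequentially. \<bar>lam n - fracdiff d (n div s) * K (int n)\<bar> \<le> B * \<rho> ^ n)"
  proof (rule smoothing[OF s_ge_1 \<rho> extend0_geometric[OF f \<rho>(1)], where q = "extend0 (frac_coeff s d)"])
    show "extend0 (frac_coeff s d) j = 0" if "\<not> int s dvd j" for j
      using that by (auto simp: extend0_def frac_coeff_eq[OF s_ge_1] int_dvd_int_iff[symmetric])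
    show "\<bar>extend0 (frac_coeff s d) (int s * i)\<bar> \<le> \<bar>fracdiff d (nat \<bar>i\<bar>)\<bar>" for i
    proof (cases "i \<ge> 0")
      case True
      thus ?thesis using mult[of "nat i"] by simp
    next
      case False
      hence "int s * i < 0" using s_ge_1 by (intro mult_pos_neg) auto
      thus ?thesis by (simp add: extend0_def)
    qed
    show "((\<lambda>m. extend0 (arma_coeff \<alpha> \<beta>) m * extend0 (frac_coeff s d) (int n - m)) has_sum lam n) UNIV" for n
      using coeff_convolution[of "int n"] by (simp add: extend0_def[of lam])
  qed (rule mult fracdiff_dichotomy)+
  thus ?thesis unfolding total using \<rho> by blast
qed

end

theorem theorem2p3:
  fixes M :: "'a measure"
    and p q s :: nat
    and d \<omega> \<theta> \<gamma> :: real
    and \<alpha> \<beta> :: "real poly"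
    and Z \<sigma> X :: "int \<Rightarrow> 'a \<Rightarrow> real"
  defines "lam \<equiv> sfiegarch_coeff \<alpha> \<beta> s d"
    and "C1 \<equiv> cov M (g_proc M \<theta> \<gamma> Z 0) (log_sq Z 0)"
    and "\<gamma>A \<equiv> gamma_A \<alpha> \<beta>"
    and "\<gamma>V \<equiv> gamma_V s d (prob_space.variance M (g_proc M \<theta> \<gamma> Z 0))"
  assumes "sfiegarch M p d q s \<omega> \<theta> \<gamma> \<alpha> \<beta> Z \<sigma> X"
    and "d < 1/2"
    and "\<not> (\<gamma> = 0 \<and> \<theta> = 0)"
    and "AE x in M. Z 0 x \<noteq> 0" and "has_finite_variance M (log_sq Z 0)"
  shows "weakly_stationary M (log_sq X) \<and> weakly_stationary M (log_sq \<sigma>) \<and>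
    (\<forall>h. autocov M (log_sq X) h =
           autocov M (log_sq \<sigma>) h + C1 * lam (nat (\<bar>h\<bar> - 1)) * indicator (UNIV - {0}) h
             + prob_space.variance M (log_sq Z 0) * indicator {0} h) \<and>
    (\<forall>h. \<forall>r<s.
       ((\<lambda>k. \<gamma>A (int s * k + int r) * \<gamma>V (int s * h - int s * k)) has_sum
          autocov M (log_sq \<sigma>) (int s * h + int r)) UNIV) \<and>
    \<gamma>A summable_on UNIV \<and>
    (\<exists>(G :: int \<Rightarrow> real) (K :: int \<Rightarrow> real).
       ((\<lambda>h::nat. \<Sum>r<s. G (int (s * h + r))) \<longlonglongrightarrow> (\<Sum>\<^sub>\<infinity>k. \<gamma>A k)) \<and>
       ((\<lambda>k::nat. \<Sum>r<s. K (int (s * k + r))) \<longlonglongrightarrow> poly \<alpha> 1 / poly \<beta> 1) \<and>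
       (\<forall>r<s. \<forall>\<nu>>0.
          (\<lambda>h. autocov M (log_sq \<sigma>) (int (s * h + r)) - \<gamma>V (int (s * h)) * G (int (s * h + r)))
            \<in> o(\<lambda>h::nat. real h powr (- \<nu>)) \<and>
          (\<lambda>h. lam (s * h + r) - frac_coeff s d (s * h) * K (int (s * h + r)))
            \<in> o(\<lambda>h::nat. real h powr (- \<nu>))) \<and>
       (\<forall>\<nu>>0. \<forall>r<s.
          (\<lambda>h. autocov M (log_sq X) (int (s * h + r)) -
                 (\<gamma>V (int (s * h)) * G (int (s * h + r))
                  + C1 * frac_coeff s d (nat (int s * \<lfloor>(real (s * h + r) - 1) / real s\<rfloor>))
                       * K (int (s * h + r) - 1)))
            \<in> o(\<lambda>h::nat. real h powr (- \<nu>))))"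
proof -
  interpret sfiegarch M p d q s \<omega> \<theta> \<gamma> \<alpha> \<beta> Z \<sigma> X by fact
  interpret L2: sfiegarch_l2 M p d q s \<omega> \<theta> \<gamma> \<alpha> \<beta> Z \<sigma> X
    by (rule sfiegarch_l2[OF assms(6)])
  note d = assms(6) and Z_nz = assms(8) and Z_fv = assms(9)
  have s: "s \<ge> 1" by (rule s_ge_1)
  have acX: "autocov M (log_sq X) h =
      autocov M (log_sq \<sigma>) h + C1 * lam (nat (\<bar>h\<bar> - 1)) * indicator (UNIV - {0}) h
        + variance (log_sq Z 0) * indicator {0} h" for h
  proof -
    have comm: "- 1 - h = - h - 1" by simp
    have "extend0 lam (h - 1 - 0) + extend0 lam (0 - 1 - h) = lam (nat (\<bar>h\<bar> - 1)) * indicator (UNIV - {0}) h"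
      by (cases h "0 :: int" rule: linorder_cases) (auto simp: extend0_def comm)
    thus ?thesis
      using L2.cov_log_sq_X[OF Z_nz Z_fv, of h 0]
      by (simp add: autocov_def C1_def lam_def indicator_def mult.assoc)
  qed
  have acS: "((\<lambda>k. \<gamma>A (int s * k + int r) * \<gamma>V (int s * h - int s * k)) has_sum
      autocov M (log_sq \<sigma>) (int s * h + int r)) UNIV" for h r
  proof -
    have "\<gamma>V j = 0" if "\<not> int s dvd j" for j using that by (simp add: \<gamma>V_def gamma_V_def)
    from has_sum_residue_class[where q = \<gamma>V, OF s this, of \<gamma>A h "int r"]
    show ?thesis
      using L2.autocov_log_sq_\<sigma>_has_sum[OF d, of "int s * h + int r"] by (simp add: \<gamma>A_def \<gamma>V_def)
  qed
  obtain G B \<rho> where G: "(\<lambda>h. \<Sum>r<s. G (int (s * h + r))) \<longlonglongrightarrow> (\<Sum>\<^sub>\<infinity>k. \<gamma>A k)"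
    and \<rho>: "0 < \<rho>" "\<rho> < 1"
    and Gb: "\<forall>\<^sub>F n in sequentially.
      \<bar>autocov M (log_sq \<sigma>) (int n) - \<gamma>V (int s * int (n div s)) * G (int n)\<bar> \<le> B * \<rho> ^ n"
    using L2.autocov_\<sigma>_smoothing(2)[OF d] unfolding \<gamma>A_def \<gamma>V_def by blast
  obtain K B' \<rho>' where K: "(\<lambda>h. \<Sum>r<s. K (int (s * h + r))) \<longlonglongrightarrow> poly \<alpha> 1 / poly \<beta> 1"
    and \<rho>': "0 < \<rho>'" "\<rho>' < 1"
    and Kb: "\<forall>\<^sub>F n in sequentially. \<bar>lam n - fracdiff d (n div s) * K (int n)\<bar> \<le> B' * \<rho>' ^ n"
    using L2.coeff_smoothing unfolding lam_def by blast
  have E1: "(\<lambda>h. autocov M (log_sq \<sigma>) (int (s * h + r)) - \<gamma>V (int (s * h)) * G (int (s * h + r)))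
      \<in> o(\<lambda>h. real h powr (- \<nu>))" if "r < s" for r \<nu>
    by (rule geometric_bound_smallo[OF \<rho> s Gb, where c = 1 and r = r and m = 0])
       (use that in simp)
  have E2: "(\<lambda>h. lam (s * h + r) - frac_coeff s d (s * h) * K (int (s * h + r)))
      \<in> o(\<lambda>h. real h powr (- \<nu>))" if "r < s" for r \<nu>
    by (rule geometric_bound_smallo[OF \<rho>' s Kb, where c = 1 and r = r and m = 0])
       (use that in \<open>simp add: frac_coeff_multiple[OF s]\<close>)
  have E3: "(\<lambda>h. autocov M (log_sq X) (int (s * h + r)) -
       (\<gamma>V (int (s * h)) * G (int (s * h + r))
        + C1 * frac_coeff s d (nat (int s * \<lfloor>(real (s * h + r) - 1) / real s\<rfloor>))
             * K (int (s * h + r) - 1))) \<in> o(\<lambda>h. real h powr (- \<nu>))" if r: "r < s" for r \<nu>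
  proof -
    let ?e = "\<lambda>h. autocov M (log_sq X) (int (s * h + r)) -
       (\<gamma>V (int (s * h)) * G (int (s * h + r))
        + C1 * frac_coeff s d (nat (int s * \<lfloor>(real (s * h + r) - 1) / real s\<rfloor>))
             * K (int (s * h + r) - 1))"
    let ?e1 = "\<lambda>h. autocov M (log_sq \<sigma>) (int (s * h + r)) - \<gamma>V (int (s * h)) * G (int (s * h + r))"
    have "(\<lambda>h. ?e h - ?e1 h) \<in> o(\<lambda>h. real h powr (- \<nu>))"
    proof (rule geometric_bound_smallo[OF \<rho>' s Kb, where c = C1 and r = r and m = 1])
      show "\<forall>\<^sub>F h in sequentially. ?e h - ?e1 h = C1 * (lam (s * h + r - 1)
          - fracdiff d ((s * h + r - 1) div s) * K (int (s * h + r - 1)))"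
        using eventually_ge_at_top[of 1]
      proof eventually_elim
        case (elim h)
        define n where "n = s * h + r"
        have "1 * 1 \<le> s * h" using s elim by (intro mult_le_mono)
        hence n: "n \<ge> 1" unfolding n_def by linarith
        have "\<lfloor>(real n - 1) / real s\<rfloor> = int ((n - 1) div s)"
          using n floor_divide_of_nat_eq[of "n - 1" s] by (simp add: of_nat_diff)
        hence "nat (int s * \<lfloor>(real n - 1) / real s\<rfloor>) = s * ((n - 1) div s)"
          by (simp add: nat_mult_distrib)
        hence lagged: "frac_coeff s d (nat (int s * \<lfloor>(real n - 1) / real s\<rfloor>)) = fracdiff d ((n - 1) div s)"
          by (simp add: frac_coeff_multiple[OF s])
        have X: "autocov M (log_sq X) (int n) = autocov M (log_sq \<sigma>) (int n) + C1 * lam (n - 1)"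
          using acX[of "int n"] n by (simp add: nat_diff_distrib)
        have cast: "int n - 1 = int (n - 1)" using n by simp
        have "(x + C1 * l - (y + C1 * f * k)) - (x - y) = C1 * (l - f * k)" for x y l f k :: real
          by (simp add: algebra_simps)
        thus ?case unfolding n_def[symmetric] lagged X cast .
      qed
    qed
    from sum_in_smallo(1)[OF this E1[OF r]] show ?thesis by (simp only: diff_add_cancel)
  qed
  show ?thesis
    using L2.weakly_stationary_log_sq_X[OF Z_nz Z_fv] L2.weakly_stationary_log_sq_\<sigma> acX acS
      L2.autocov_\<sigma>_smoothing(1)[OF d] G K E1 E2 E3
    unfolding \<gamma>A_def[symmetric]
    by (intro conjI exI[of _ G] exI[of _ K]) blast+
qed

end
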